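(* Let $\alpha,\beta\in(0,\infty]$ be fixed and let $n\to\infty$. Let $N_\alpha$ and $N_\beta$ be the total numbers of symbols $\alpha$ and $\beta$ in the random $\alpha/\beta$-staircase tableau $S_{n,\alpha,\beta}$. Then, with $a:=\alpha^{-1}$ and $b:=\beta^{-1}$ (where $\infty^{-1}=0$), $$\mathbb E N_\alpha=n-a\log n+O(1),$$ $$\operatorname{Var}N_\alpha=a\log n+O(1),$$ $$\operatorname{Cov}(N_\alpha,N_\beta)=O(1).$$ Furthermore, $$\frac{N_\alpha-\mathbb E N_\alpha}{\sqrt{\log n}}\overset{\mathrm d}{\longrightarrow}N(0,a),\qquad \frac{N_\beta-\mathbb E N_\beta}{\sqrt{\log n}}\overset{\mathrm d}{\longrightarrow}N(0,b),$$ jointly, with independent limits.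
   Context: An $\alpha/\beta$-staircase tableau of size $n\ge1$ is a filling of the Young diagram of shape $(n,n-1,\dots,2,1)$, whose boxes are $(i,j)$ (row $i$ from the top, column $j$ from the left) with $i,j\ge1$, $i+j\le n+1$, such that: each box is empty or contains one of the symbols $\alpha,\beta$; no diagonal box (box with $i+j=n+1$) is empty; all boxes in the same row and to the left of a $\beta$ are empty; all boxes in the same column and above an $\alpha$ are empty. Let $\bar{\mathcal S}_n$ be the set of these tableaux. For $S\in\bar{\mathcal S}_n$ let $N_\alpha(S),N_\beta(S)$ be the numbers of symbols $\alpha$ and $\beta$ in $S$; in $N_\alpha,N_\beta$ the subscripts are symbols, not parameter values, and $N_\alpha:=N_\alpha(S_{n,\alpha,\beta})$, $N_\beta:=N_\beta(S_{n,\alpha,\beta})$. For parameter values $\alpha,\beta\in(0,\infty)$, $S_{n,\alpha,\beta}$ is the random element of $\bar{\mathcal S}_n$ with $\mathbb P(S_{n,\alpha,\beta}=S)=\alpha^{N_\alpha(S)}\beta^{N_\beta(S)}/Z_n(\alpha,\beta)$, where $Z_n(\alpha,\beta)=\sum_{S\in\bar{\mathcal S}_n}\alpha^{N_\alpha(S)}\beta^{N_\beta(S)}$. If exactly one of $\alpha,\beta$ is $\infty$, the distribution is the limit of this one as that parameter tends to $\infty$ with the other fixed; if $\alpha=\beta=\infty$, it is the limit as $\alpha=\beta\to\infty$. $N(0,\sigma^2)$ is the normal distribution with mean $0$ and variance $\sigma^2$ (a point mass at $0$ if $\sigma^2=0$), and $\overset{\mathrm d}{\longrightarrow}$ is convergence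 in distribution. *)

theory Defs
  imports "HOL-Probability.Probability" "HOL-Library.Landau_Symbols"
begin

datatype symbol = Alpha | Beta

definition staircase :: "nat \<Rightarrow> (nat \<times> nat) set" where
  "staircase n = {(i, j). 1 \<le> i \<and> 1 \<le> j \<and> i + j \<le> n + 1}"

text \<open>
  A filling maps box \<open>(row, column)\<close> to its content; \<open>None\<close> is an empty box, and is the
  value imposed outside the diagram, so that distinct functions are distinct tableaux.
\<close>

type_synonym filling = "nat \<times> nat \<Rightarrow> symbol option"

definition tableaux :: "nat \<Rightarrow> filling set" where
  "tableaux n = {S.
     (\<forall>p. p \<notin> staircase n \<longrightarrow> S p = None) \<and>
     (\<forall>i j. (i, j) \<in> staircase n \<and> i + j = n + 1 \<longrightarrow> S (i, j) \<noteq> None) \<and>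
     (\<forall>i j j'. S (i, j) = Some Beta \<and> j' < j \<longrightarrow> S (i, j') = None) \<and>
     (\<forall>i i' j. S (i, j) = Some Alpha \<and> i' < i \<longrightarrow> S (i', j) = None)}"

definition count_symbol :: "symbol \<Rightarrow> filling \<Rightarrow> nat" where
  "count_symbol s S = card {p. S p = Some s}"

definition N_alpha :: "filling \<Rightarrow> real" where
  "N_alpha S = real (count_symbol Alpha S)"

definition N_beta :: "filling \<Rightarrow> real" where
  "N_beta S = real (count_symbol Beta S)"

definition weight :: "real \<Rightarrow> real \<Rightarrow> filling \<Rightarrow> real" where
  "weight x y S = x ^ count_symbol Alpha S * y ^ count_symbol Beta S"

definition partition_fun :: "nat \<Rightarrow> real \<Rightarrow> real \<Rightarrow> real" where
  "partition_fun n x y = (\<Sum>S\<in>tableaux n. weight x y S)"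

definition finite_prob :: "nat \<Rightarrow> real \<Rightarrow> real \<Rightarrow> filling \<Rightarrow> real" where
  "finite_prob n x y S = (if S \<in> tableaux n then weight x y S / partition_fun n x y else 0)"

text \<open>
  The limits below exist (lemma \<open>tendsto_tableau_prob\<close>); since there are only finitely many
  tableaux, pointwise convergence of the probabilities is convergence of the distributions.
\<close>

definition tableau_prob :: "nat \<Rightarrow> ennreal \<Rightarrow> ennreal \<Rightarrow> filling \<Rightarrow> real" where
  "tableau_prob n \<alpha> \<beta> S =
    (if \<alpha> \<noteq> \<infinity> \<and> \<beta> \<noteq> \<infinity> then finite_prob n (enn2real \<alpha>) (enn2real \<beta>) S
     else if \<beta> \<noteq> \<infinity> then Lim at_top (\<lambda>x. finite_prob n x (enn2real \<beta>) S)
     else if \<alpha> \<noteq> \<infinity> then Lim at_top (\<lambda>y. finite_prob n (enn2real \<alpha>) y S)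
     else Lim at_top (\<lambda>x. finite_prob n x x S))"

definition tableau_pmf :: "nat \<Rightarrow> ennreal \<Rightarrow> ennreal \<Rightarrow> filling pmf" where
  "tableau_pmf n \<alpha> \<beta> = embed_pmf (tableau_prob n \<alpha> \<beta>)"

definition covariance :: "'a measure \<Rightarrow> ('a \<Rightarrow> real) \<Rightarrow> ('a \<Rightarrow> real) \<Rightarrow> real" where
  "covariance M X Y =
    (\<integral>\<omega>. (X \<omega> - (\<integral>\<omega>'. X \<omega>' \<partial>M)) * (Y \<omega> - (\<integral>\<omega>'. Y \<omega>' \<partial>M)) \<partial>M)"

text \<open>
  Parametrised by the variance. The case split is needed since \<open>normal_density 0 0\<close> is
  identically zero.
\<close>

definition centered_normal :: "real \<Rightarrow> real measure" where
  "centered_normal v =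
    (if v = 0 then return borel 0 else density lborel (normal_density 0 (sqrt v)))"

text \<open>
  Weak convergence of Borel measures on an arbitrary topological space; \<open>weak_conv_m\<close> is
  restricted to the real line, whereas joint convergence of two variables takes place in the plane.
\<close>

definition weakly_converges ::
    "(nat \<Rightarrow> 'a::topological_space measure) \<Rightarrow> 'a measure \<Rightarrow> bool" where
  "weakly_converges M L \<longleftrightarrow>
    (\<forall>f :: 'a \<Rightarrow> real. continuous_on UNIV f \<and> bounded (range f) \<longrightarrow>
       (\<lambda>n. \<integral>x. f x \<partial>M n) \<longlonglongrightarrow> (\<integral>x. f x \<partial>L))"

lemma finite_tableaux: "finite (tableaux n)"
proof -
  have sub: "staircase n \<subseteq> {..n} \<times> {..n}"
    by (auto simp: staircase_def)
  have "finite (staircase n)"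
    by (rule finite_subset[OF sub]) simp
  moreover have "(UNIV :: symbol option set) = {None, Some Alpha, Some Beta}"
  proof -
    have "x \<in> {None, Some Alpha, Some Beta}" for x :: "symbol option"
    proof (cases x)
      case (Some s) then show ?thesis by (cases s) auto
    qed auto
    then show ?thesis by blast
  qed
  then have "finite (UNIV :: symbol option set)"
    by (metis finite.emptyI finite.insertI)
  ultimately have "finite {S :: filling. \<forall>p. (p \<in> staircase n \<longrightarrow> S p \<in> UNIV) \<and>
      (p \<notin> staircase n \<longrightarrow> S p = None)}"
    by (rule finite_set_of_finite_funs)
  then show ?thesis
    by (rule rev_finite_subset) (auto simp: tableaux_def)
qed

lemma tableaux_nonempty: "tableaux n \<noteq> {}"
proof -
  have "(\<lambda>(i, j). if 1 \<le> i \<and> 1 \<le> j \<and> i + j = n + 1 then Some Alpha else None) \<in> tableaux n"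
    by (auto simp: tableaux_def staircase_def split: if_splits)
  then show ?thesis by blast
qed

lemma weight_pos: "x > 0 \<Longrightarrow> y > 0 \<Longrightarrow> weight x y S > 0"
  by (simp add: weight_def)

lemma partition_fun_pos: "x > 0 \<Longrightarrow> y > 0 \<Longrightarrow> partition_fun n x y > 0"
  unfolding partition_fun_def
  by (intro sum_pos finite_tableaux tableaux_nonempty weight_pos)

lemma finite_prob_nonneg: "x > 0 \<Longrightarrow> y > 0 \<Longrightarrow> finite_prob n x y S \<ge> 0"
  using weight_pos[of x y S] partition_fun_pos[of x y n] by (auto simp: finite_prob_def)

lemma sum_finite_prob:
  assumes "x > 0" "y > 0"
  shows "(\<Sum>S\<in>tableaux n. finite_prob n x y S) = 1"
proof -
  have "(\<Sum>S\<in>tableaux n. finite_prob n x y S) =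
      (\<Sum>S\<in>tableaux n. weight x y S / partition_fun n x y)"
    by (intro sum.cong) (auto simp: finite_prob_def)
  also have "\<dots> = partition_fun n x y / partition_fun n x y"
    unfolding partition_fun_def by (rule sum_divide_distrib[symmetric])
  finally show ?thesis
    using partition_fun_pos[OF assms, of n] by simp
qed

lemma tendsto_ratio:
  fixes c :: "'a \<Rightarrow> real" and d :: "'a \<Rightarrow> nat"
  assumes A: "finite A" "A \<noteq> {}" and c: "\<And>t. t \<in> A \<Longrightarrow> c t > 0" and s: "s \<in> A"
  shows "\<exists>L. ((\<lambda>x. c s * x ^ d s / (\<Sum>t\<in>A. c t * x ^ d t)) \<longlongrightarrow> L) at_top"
proof -
  define D where "D = Max (d ` A)"
  have le: "d t \<le> D" if "t \<in> A" for t
    using A that by (simp add: D_def)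
  have "D \<in> d ` A"
    unfolding D_def using A by (intro Max_in) auto
  then obtain m where m: "m \<in> A" "d m = D" by auto
  have lim: "((\<lambda>x::real. x ^ d t / x ^ D) \<longlongrightarrow> (if d t = D then 1 else 0)) at_top"
    if "t \<in> A" for t
  proof (cases "d t = D")
    case True
    have "eventually (\<lambda>x::real. x ^ d t / x ^ D = 1) at_top"
      using eventually_gt_at_top[of 0] by eventually_elim (simp add: True)
    then show ?thesis
      using True by (simp add: tendsto_eventually)
  next
    case False
    with le[OF that] have lt: "d t < D" by simp
    have "((\<lambda>x::real. inverse (x ^ (D - d t))) \<longlongrightarrow> 0) at_top"
      using lt by (intro tendsto_inverse_0_at_top filterlim_pow_at_top filterlim_ident) auto
    moreover have "eventually (\<lambda>x::real. inverse (x ^ (D - d t)) = x ^ d t / x ^ D) at_top"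
      using eventually_gt_at_top[of 0]
      by eventually_elim (use lt in \<open>simp add: power_diff field_simps\<close>)
    ultimately show ?thesis
      using False by (simp add: tendsto_cong)
  qed
  let ?Z = "\<Sum>t\<in>A. c t * (if d t = D then 1 else 0)"
  have "0 < c m * (if d m = D then 1 else 0)"
    using m c by simp
  also have "\<dots> \<le> ?Z"
    using A m c by (intro member_le_sum) (auto simp: less_imp_le)
  finally have Z: "?Z \<noteq> 0" by simp
  have "((\<lambda>x. (c s * (x ^ d s / x ^ D)) / (\<Sum>t\<in>A. c t * (x ^ d t / x ^ D))) \<longlongrightarrow>
      (c s * (if d s = D then 1 else 0)) / ?Z) at_top"
    by (intro tendsto_divide tendsto_mult tendsto_sum tendsto_const lim s Z)
  moreover have "eventually (\<lambda>x. (c s * (x ^ d s / x ^ D)) / (\<Sum>t\<in>A. c t * (x ^ d t / x ^ D)) =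
      c s * x ^ d s / (\<Sum>t\<in>A. c t * x ^ d t)) at_top"
    using eventually_gt_at_top[of 0]
  proof eventually_elim
    case (elim x)
    have "(\<Sum>t\<in>A. c t * (x ^ d t / x ^ D)) = (\<Sum>t\<in>A. c t * x ^ d t) / x ^ D"
      by (simp add: sum_divide_distrib)
    then show ?case using elim by simp
  qed
  ultimately show ?thesis
    by (intro exI) (rule Lim_transform_eventually)
qed

lemma tendsto_finite_prob:
  assumes eq: "\<And>S x. S \<in> tableaux n \<Longrightarrow> weight (u x) (v x) S = c S * x ^ d S"
    and c: "\<And>S. S \<in> tableaux n \<Longrightarrow> c S > 0"
  shows "((\<lambda>x. finite_prob n (u x) (v x) S) \<longlongrightarrow> Lim at_top (\<lambda>x. finite_prob n (u x) (v x) S)) at_top"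
proof -
  have "\<exists>L. ((\<lambda>x. finite_prob n (u x) (v x) S) \<longlongrightarrow> L) at_top"
  proof (cases "S \<in> tableaux n")
    case True
    then show ?thesis
      using tendsto_ratio[OF finite_tableaux tableaux_nonempty c True, of "\<lambda>S. S" d]
      by (simp add: finite_prob_def partition_fun_def eq)
  qed (auto simp: finite_prob_def)
  then obtain L where L: "((\<lambda>x. finite_prob n (u x) (v x) S) \<longlongrightarrow> L) at_top" ..
  show ?thesis
    using L by (simp only: tendsto_Lim[OF trivial_limit_at_top_linorder L])
qed

lemma enn2real_pos: "c > 0 \<Longrightarrow> c \<noteq> \<infinity> \<Longrightarrow> enn2real c > 0"
  by (metis enn2real_positive_iff infinity_ennreal_def less_top)

lemma tendsto_tableau_prob:
  assumes "\<alpha> > 0" "\<beta> > 0"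
  shows
    "\<beta> \<noteq> \<infinity> \<Longrightarrow> ((\<lambda>x. finite_prob n x (enn2real \<beta>) S) \<longlongrightarrow> tableau_prob n \<infinity> \<beta> S) at_top"
    "\<alpha> \<noteq> \<infinity> \<Longrightarrow> ((\<lambda>y. finite_prob n (enn2real \<alpha>) y S) \<longlongrightarrow> tableau_prob n \<alpha> \<infinity> S) at_top"
    "((\<lambda>x. finite_prob n x x S) \<longlongrightarrow> tableau_prob n \<infinity> \<infinity> S) at_top"
proof -
  assume "\<beta> \<noteq> \<infinity>"
  then have "enn2real \<beta> > 0"
    using assms by (simp add: enn2real_pos)
  then show "((\<lambda>x. finite_prob n x (enn2real \<beta>) S) \<longlongrightarrow> tableau_prob n \<infinity> \<beta> S) at_top"
    using tendsto_finite_prob[of n "\<lambda>x. x" "\<lambda>_. enn2real \<beta>"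
        "\<lambda>S. enn2real \<beta> ^ count_symbol Beta S" "count_symbol Alpha"] \<open>\<beta> \<noteq> \<infinity>\<close>
    by (simp add: tableau_prob_def weight_def mult.commute)
next
  assume "\<alpha> \<noteq> \<infinity>"
  then have "enn2real \<alpha> > 0"
    using assms by (simp add: enn2real_pos)
  then show "((\<lambda>y. finite_prob n (enn2real \<alpha>) y S) \<longlongrightarrow> tableau_prob n \<alpha> \<infinity> S) at_top"
    using tendsto_finite_prob[of n "\<lambda>_. enn2real \<alpha>" "\<lambda>x. x"
        "\<lambda>S. enn2real \<alpha> ^ count_symbol Alpha S" "count_symbol Beta"] \<open>\<alpha> \<noteq> \<infinity>\<close>
    by (simp add: tableau_prob_def weight_def)
next
  show "((\<lambda>x. finite_prob n x x S) \<longlongrightarrow> tableau_prob n \<infinity> \<infinity> S) at_top"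
    using tendsto_finite_prob[of n "\<lambda>x. x" "\<lambda>x. x" "\<lambda>_. 1"
        "\<lambda>S. count_symbol Alpha S + count_symbol Beta S"]
    by (simp add: tableau_prob_def weight_def power_add)
qed

lemma
  assumes "\<alpha> > 0" "\<beta> > 0"
  shows tableau_prob_nonneg: "\<And>S. tableau_prob n \<alpha> \<beta> S \<ge> 0"
    and sum_tableau_prob: "(\<Sum>S\<in>tableaux n. tableau_prob n \<alpha> \<beta> S) = 1"
    and tableau_prob_outside: "\<And>S. S \<notin> tableaux n \<Longrightarrow> tableau_prob n \<alpha> \<beta> S = 0"
proof -
  let ?P = "\<lambda>u v :: real \<Rightarrow> real. (\<forall>x>0. u x > 0 \<and> v x > 0) \<and>
      (\<forall>S. ((\<lambda>x. finite_prob n (u x) (v x) S) \<longlongrightarrow> tableau_prob n \<alpha> \<beta> S) at_top)"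
  note pos = enn2real_pos[OF assms(1)] enn2real_pos[OF assms(2)]
  note lims = tendsto_tableau_prob[OF assms]
  have "\<exists>u v. ?P u v"
  proof (cases "\<alpha> = \<infinity>"; cases "\<beta> = \<infinity>")
    assume "\<alpha> = \<infinity>" "\<beta> = \<infinity>"
    then have "?P (\<lambda>x. x) (\<lambda>x. x)" using lims(3) by simp
    then show ?thesis by (intro exI)
  next
    assume "\<alpha> = \<infinity>" "\<beta> \<noteq> \<infinity>"
    then have "?P (\<lambda>x. x) (\<lambda>_. enn2real \<beta>)" using lims(1) pos by simp
    then show ?thesis by (intro exI)
  next
    assume "\<alpha> \<noteq> \<infinity>" "\<beta> = \<infinity>"
    then have "?P (\<lambda>_. enn2real \<alpha>) (\<lambda>x. x)" using lims(2) pos by simp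
    then show ?thesis by (intro exI)
  next
    assume "\<alpha> \<noteq> \<infinity>" "\<beta> \<noteq> \<infinity>"
    then have "?P (\<lambda>_. enn2real \<alpha>) (\<lambda>_. enn2real \<beta>)"
      using pos by (simp add: tableau_prob_def)
    then show ?thesis by (intro exI)
  qed
  then obtain u v :: "real \<Rightarrow> real" where uv_pos: "\<And>x. x > 0 \<Longrightarrow> u x > 0 \<and> v x > 0"
    and lim: "\<And>S. ((\<lambda>x. finite_prob n (u x) (v x) S) \<longlongrightarrow> tableau_prob n \<alpha> \<beta> S) at_top"
    by blast
  have ev: "eventually (\<lambda>x. u x > 0 \<and> v x > 0) at_top"
    using eventually_gt_at_top[of 0] by eventually_elim (rule uv_pos)
  show "tableau_prob n \<alpha> \<beta> S \<ge> 0" for S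
  proof (rule tendsto_lowerbound[OF lim])
    show "eventually (\<lambda>x. finite_prob n (u x) (v x) S \<ge> 0) at_top"
      using ev by eventually_elim (simp add: finite_prob_nonneg)
  qed simp
  show "tableau_prob n \<alpha> \<beta> S = 0" if "S \<notin> tableaux n" for S
    using lim[of S] that by (simp add: finite_prob_def tendsto_const_iff)
  have "((\<lambda>x. \<Sum>S\<in>tableaux n. finite_prob n (u x) (v x) S) \<longlongrightarrow>
      (\<Sum>S\<in>tableaux n. tableau_prob n \<alpha> \<beta> S)) at_top"
    by (intro tendsto_sum lim)
  moreover have "((\<lambda>x. \<Sum>S\<in>tableaux n. finite_prob n (u x) (v x) S) \<longlongrightarrow> 1) at_top"
    by (rule tendsto_eventually) (use ev in eventually_elim, simp add: sum_finite_prob)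
  ultimately show "(\<Sum>S\<in>tableaux n. tableau_prob n \<alpha> \<beta> S) = 1"
    by (rule tendsto_unique[OF trivial_limit_at_top_linorder])
qed

lemma pmf_tableau_pmf:
  assumes "\<alpha> > 0" "\<beta> > 0"
  shows "pmf (tableau_pmf n \<alpha> \<beta>) S = tableau_prob n \<alpha> \<beta> S"
proof -
  note [simp] = tableau_prob_nonneg[OF assms]
  have "(\<integral>\<^sup>+S. ennreal (tableau_prob n \<alpha> \<beta> S) \<partial>count_space UNIV) =
      (\<Sum>S\<in>tableaux n. ennreal (tableau_prob n \<alpha> \<beta> S))"
    by (rule nn_integral_count_space') (auto simp: finite_tableaux tableau_prob_outside[OF assms])
  also have "\<dots> = 1"
    by (simp add: sum_tableau_prob[OF assms])
  finally show ?thesis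
    unfolding tableau_pmf_def by (intro pmf_embed_pmf) auto
qed

end

theory Submission
  imports Defs
begin

text \<open>
  The pair of symbol counts has the law of a sum of independent contributions, one for each
  \<open>i < n\<close>, and everything follows from this.
  
  Removing the first column of a tableau of size \<open>n + 1\<close> leaves a tableau of size \<open>n\<close>, and the
  symbols that the removed column may carry depend only on which rows of the smaller tableau are free
  of \<open>\<beta>\<close>. Recording the number of these rows by a third variable \<open>z\<close> turns the removal into the
  substitution \<open>z \<mapsto> y + z\<close> and a linear factor; iterating it gives the generating function
  \<open>\<Prod>i<n. x + y + i x y\<close> (\<open>refined_generating_function\<close>). With \<open>x = \<alpha> s\<close>, \<open>y = \<beta> t\<close> and
  normalization, the probability generating function is a product of factors
  \<open>q\<^sub>i s + p\<^sub>i t + (1 - p\<^sub>i - q\<^sub>i) s t\<close>, where \<open>p\<^sub>i = a / (a + b + i)\<close> and \<open>q\<^sub>i = b / (a + b + i)\<close>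
  (\<open>probability_generating_function\<close>); infinite parameters are covered by passing to the limit. So the
  \<open>i\<close>-th step contributes a single \<open>\<alpha>\<close> with probability \<open>q\<^sub>i\<close>, a single \<open>\<beta>\<close> with probability \<open>p\<^sub>i\<close>,
  and both symbols otherwise.
  
  Hence the mean and the variance of \<open>N\<^sub>\<alpha>\<close> are \<open>\<Sum>i<n. 1 - p\<^sub>i\<close> and \<open>\<Sum>i<n. p\<^sub>i (1 - p\<^sub>i)\<close>, and the
  covariance is \<open>- (\<Sum>i<n. p\<^sub>i q\<^sub>i)\<close>. As \<open>p\<^sub>i\<close> differs from \<open>a / (i + 1)\<close> by a summable amount, the
  asymptotics are those of the harmonic numbers, and sums of products of two such probabilities stay
  bounded. For the limit law, each factor of the joint characteristic function of the centred counts is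
  close to the Gaussian one with the same variance (\<open>step_char_approx\<close>), so that the product converges
  to the product of two Gaussian characteristic functions (\<open>joint_char_limit\<close>): the bounded covariance
  disappears after division by \<open>log n\<close>.
  
  It remains to pass from characteristic functions to weak convergence in the plane. When the limit is
  a product measure this reduces to Levy's theorem on the line: a bounded nonnegative function of one
  coordinate is used as a density, and the one-dimensional theorem is applied to the other coordinate
  under the reweighted measures (\<open>weighted_levy_continuity\<close>). This gives convergence for products of
  test functions of the two coordinates, which suffices by the Stone-Weierstrass theorem
  (\<open>product_test_functions_imp_weakly_converges\<close>).
\<close>

section \<open>Columns of a tableau\<close>

text \<open>
  The possible contents of one column, given the set \<open>F\<close> of rows in which the box of this column is
  allowed to be nonempty.
\<close>
definition column_fillings :: "nat set \<Rightarrow> (nat \<Rightarrow> symbol option) set" where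
  "column_fillings F = {c. (\<forall>i. i \<notin> F \<longrightarrow> c i = None) \<and>
     (\<forall>i i'. c i = Some Alpha \<and> i' < i \<longrightarrow> c i' = None)}"

text \<open>
  The exponent of \<open>z\<close> counts the rows that still contain no \<open>\<beta>\<close>, so a \<open>\<beta>\<close> loses the factor \<open>z\<close>.
\<close>
fun box_weight :: "'a::comm_semiring_1 \<Rightarrow> 'a \<Rightarrow> 'a \<Rightarrow> symbol option \<Rightarrow> 'a" where
  "box_weight x y z None = z"
| "box_weight x y z (Some Alpha) = x * z"
| "box_weight x y z (Some Beta) = y"

lemma symbol_option_cases:
  obtains "s = None" | "s = Some Alpha" | "s = Some Beta"
  by (metis option.exhaust symbol.exhaust)

lemma column_fillings_empty: "column_fillings {} = {\<lambda>_. None}"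
  by (auto simp: column_fillings_def)

lemma finite_column_fillings:
  assumes "finite F" shows "finite (column_fillings F)"
proof -
  have "finite {None, Some Alpha, Some Beta}" by simp
  moreover have "(UNIV :: symbol option set) = {None, Some Alpha, Some Beta}"
    by (rule UNIV_eq_I) (metis symbol_option_cases insertCI)
  ultimately have "finite (UNIV :: symbol option set)" by simp
  then have "finite {c :: nat \<Rightarrow> symbol option.
      \<forall>i. (i \<in> F \<longrightarrow> c i \<in> UNIV) \<and> (i \<notin> F \<longrightarrow> c i = None)}"
    by (intro finite_set_of_finite_funs assms)
  then show ?thesis
    by (rule rev_finite_subset) (auto simp: column_fillings_def)
qed

text \<open>
  An \<open>\<alpha>\<close> in the bottom box forces the rest of the column to be empty, whereas a \<open>\<beta>\<close> there imposes
  nothing on the boxes above it.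
\<close>
lemma filled_columns_insert:
  assumes "\<forall>i\<in>F. i < m"
  shows "{c \<in> column_fillings (insert m F). c m \<noteq> None} =
    insert ((\<lambda>_. None)(m := Some Alpha)) ((\<lambda>c. c(m := Some Beta)) ` column_fillings F)"
    (is "?L = ?R")
proof
  show "?L \<subseteq> ?R"
  proof
    fix c assume c: "c \<in> ?L"
    then have out: "\<And>i. i \<noteq> m \<Longrightarrow> i \<notin> F \<Longrightarrow> c i = None"
      and alpha: "\<And>i i'. c i = Some Alpha \<Longrightarrow> i' < i \<Longrightarrow> c i' = None"
      and "c m \<noteq> None"
      by (auto simp: column_fillings_def)
    then consider "c m = Some Alpha" | "c m = Some Beta"
      by (cases "c m" rule: symbol_option_cases) auto
    then show "c \<in> ?R"
    proof cases
      case 1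
      have "c i = ((\<lambda>_. None)(m := Some Alpha)) i" for i
        using 1 alpha[OF 1] out[of i] assms by (cases "i = m") auto
      then show ?thesis by auto
    next
      case 2
      have "c(m := None) \<in> column_fillings F"
        using assms out alpha by (auto simp: column_fillings_def)
      moreover have "c = (c(m := None))(m := Some Beta)"
        using 2 by auto
      ultimately show ?thesis by blast
    qed
  qed
  show "?R \<subseteq> ?L"
  proof
    fix c assume "c \<in> ?R"
    then consider "c = (\<lambda>_. None)(m := Some Alpha)"
      | d where "c = d(m := Some Beta)" "d \<in> column_fillings F" by blast
    then show "c \<in> ?L"
    proof cases
      case 1 then show ?thesis by (auto simp: column_fillings_def)
    next
      case 2
      have "d i = None" if "i \<ge> m" for i
      proof -
        have "i \<notin> F" using assms that by force
        then show ?thesis using 2(2) by (simp add: column_fillings_def)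
      qed
      then show ?thesis
        using 2 by (auto simp: column_fillings_def)
    qed
  qed
qed

lemma empty_bottom_columns_insert:
  assumes "\<forall>i\<in>F. i < m"
  shows "{c \<in> column_fillings (insert m F). c m = None} = column_fillings F"
proof -
  have "m \<notin> F" using assms by blast
  then have "c \<in> column_fillings (insert m F) \<and> c m = None \<longleftrightarrow> c \<in> column_fillings F" for c
    by (simp add: column_fillings_def) metis
  then show ?thesis by blast
qed

definition column_sum :: "'a::comm_semiring_1 \<Rightarrow> 'a \<Rightarrow> 'a \<Rightarrow> nat set \<Rightarrow> 'a" where
  "column_sum x y z F = (\<Sum>c\<in>column_fillings F. \<Prod>i\<in>F. box_weight x y z (c i))"

lemma filled_column_sum_step:
  fixes x y z :: "'a::comm_semiring_1"
  assumes "finite F" "\<forall>i\<in>F. i < m"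
  shows "(\<Sum>c | c \<in> column_fillings (insert m F) \<and> c m \<noteq> None.
      \<Prod>i\<in>insert m F. box_weight x y z (c i)) = x * z ^ Suc (card F) + y * column_sum x y z F"
proof -
  let ?u = "(\<lambda>_. None)(m := Some Alpha)" and ?h = "\<lambda>c. c(m := Some Beta)"
  let ?g = "\<lambda>c. \<Prod>i\<in>insert m F. box_weight x y z (c i)"
  have m: "m \<notin> F" using assms by blast
  have upd: "(\<Prod>i\<in>F. box_weight x y z ((c(m := s)) i)) = (\<Prod>i\<in>F. box_weight x y z (c i))"
    for c s using m by (intro prod.cong) auto
  have inj: "inj_on ?h (column_fillings F)"
  proof (rule inj_onI)
    fix c d assume "c \<in> column_fillings F" "d \<in> column_fillings F" "?h c = ?h d"
    then have "c(m := None) = c" "d(m := None) = d" "(?h c)(m := None) = (?h d)(m := None)"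
      using m by (auto simp: column_fillings_def)
    then show "c = d" by simp
  qed
  have "?u \<notin> ?h ` column_fillings F"
    by (auto dest: fun_cong[where x = m])
  then have "sum ?g (insert ?u (?h ` column_fillings F)) = ?g ?u + sum ?g (?h ` column_fillings F)"
    using assms(1) by (intro sum.insert finite_imageI finite_column_fillings) auto
  also have "?g ?u = x * z ^ Suc (card F)"
    using assms(1) m upd[of "\<lambda>_. None"] by (simp add: mult.assoc)
  also have "sum ?g (?h ` column_fillings F) = (\<Sum>c\<in>column_fillings F. ?g (?h c))"
    by (simp add: sum.reindex[OF inj])
  also have "\<dots> = y * column_sum x y z F"
    using assms(1) m upd by (simp add: column_sum_def sum_distrib_left)
  finally show ?thesis
    by (simp only: filled_columns_insert[OF assms(2)])
qed

lemma column_sum_insert: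
  fixes x y z :: "'a::comm_semiring_1"
  assumes "finite F" "\<forall>i\<in>F. i < m"
  shows "column_sum x y z (insert m F) = (y + z) * column_sum x y z F + x * z ^ Suc (card F)"
proof -
  have m: "m \<notin> F" using assms by blast
  let ?g = "\<lambda>c. \<Prod>i\<in>insert m F. box_weight x y z (c i)"
  let ?C = "column_fillings (insert m F)"
  have "finite ?C" using assms(1) by (simp add: finite_column_fillings)
  then have "column_sum x y z (insert m F) = sum ?g {c \<in> ?C. c m = None} + sum ?g {c \<in> ?C. c m \<noteq> None}"
    unfolding column_sum_def
    by (subst sum.union_disjoint[symmetric]) (auto intro: arg_cong[where f = "sum ?g"])
  also have "sum ?g {c \<in> ?C. c m = None} = z * column_sum x y z F"
    unfolding empty_bottom_columns_insert[OF assms(2)] column_sum_def sum_distrib_left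
  proof (intro sum.cong refl)
    fix c assume "c \<in> column_fillings F"
    then have "c m = None" using m by (simp add: column_fillings_def)
    then show "?g c = z * (\<Prod>i\<in>F. box_weight x y z (c i))"
      using assms(1) m by simp
  qed
  finally show ?thesis
    using filled_column_sum_step[OF assms, of x y z] by (simp add: algebra_simps)
qed

text \<open>
  The recursion \<open>column_sum_insert\<close> produces a geometric sum in \<open>z\<close> and \<open>y + z\<close>, which telescopes after
  multiplication by \<open>y\<close>; the added power of \<open>z\<close> cancels what is left over. This combination is the one that arises for
  columns with a nonempty bottom box.
\<close>
lemma column_sum_closed_form:
  fixes x y z :: "'a::comm_semiring_1"
  assumes "finite F"
  shows "x * z ^ Suc (card F) + y * column_sum x y z F = (x * z + y) * (y + z) ^ card F"
  using assms
proof (induction F rule: finite_linorder_max_induct)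
  case empty
  then show ?case by (simp add: column_sum_def column_fillings_empty)
next
  case (insert m F)
  have m: "m \<notin> F" using insert by blast
  have "x * z ^ Suc (card (insert m F)) + y * column_sum x y z (insert m F) =
      (y + z) * (x * z ^ Suc (card F) + y * column_sum x y z F)"
    unfolding column_sum_insert[OF insert(1,2)] using insert(1) m by (simp add: algebra_simps)
  also have "\<dots> = (y + z) * ((x * z + y) * (y + z) ^ card F)"
    by (simp only: insert.IH)
  finally show ?case
    by (simp only: card_insert_disjoint[OF insert(1) m] power_Suc mult.left_commute)
qed

lemma filled_column_sum:
  fixes x y z :: "'a::comm_semiring_1"
  assumes "finite F" "\<forall>i\<in>F. i < m"
  shows "(\<Sum>c | c \<in> column_fillings (insert m F) \<and> c m \<noteq> None.
      \<Prod>i\<in>insert m F. box_weight x y z (c i)) = (x * z + y) * (y + z) ^ card F"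
  by (simp only: filled_column_sum_step[OF assms] column_sum_closed_form[OF assms(1)])

section \<open>The generating function of the symbol counts\<close>

definition free_rows :: "nat \<Rightarrow> filling \<Rightarrow> nat set" where
  "free_rows n S = {i \<in> {1..n}. \<forall>j. S (i, j) \<noteq> Some Beta}"

text \<open>
  The columns that can stand to the left of \<open>S\<close>: a box left of a \<open>\<beta>\<close> is empty, and the bottom box,
  in row \<open>n + 1\<close>, lies on the diagonal of the enlarged tableau.
\<close>
definition filled_columns :: "nat \<Rightarrow> filling \<Rightarrow> (nat \<Rightarrow> symbol option) set" where
  "filled_columns n S =
    {c \<in> column_fillings (insert (Suc n) (free_rows n S)). c (Suc n) \<noteq> None}"

definition prepend_column :: "(nat \<Rightarrow> symbol option) \<Rightarrow> filling \<Rightarrow> filling" where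
  "prepend_column c S = (\<lambda>(i, j). case j of 0 \<Rightarrow> None | Suc 0 \<Rightarrow> c i | Suc (Suc k) \<Rightarrow> S (i, Suc k))"

lemma prepend_column_simps [simp]:
  "prepend_column c S (i, 0) = None"
  "prepend_column c S (i, Suc 0) = c i"
  "prepend_column c S (i, Suc (Suc k)) = S (i, Suc k)"
  by (simp_all add: prepend_column_def)

definition drop_column :: "filling \<Rightarrow> filling" where
  "drop_column T = (\<lambda>(i, j). if j = 0 then None else T (i, Suc j))"

lemma tableauxD:
  assumes "S \<in> tableaux n"
  shows "(i, j) \<notin> staircase n \<Longrightarrow> S (i, j) = None"
    and "(i, j) \<in> staircase n \<Longrightarrow> i + j = n + 1 \<Longrightarrow> S (i, j) \<noteq> None"
    and "S (i, j) = Some Beta \<Longrightarrow> j' < j \<Longrightarrow> S (i, j') = None"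
    and "S (i, j) = Some Alpha \<Longrightarrow> i' < i \<Longrightarrow> S (i', j) = None"
  using assms unfolding tableaux_def by blast+

lemma tableaux_column_0: "S \<in> tableaux n \<Longrightarrow> S (i, 0) = None"
  by (simp add: tableauxD(1) staircase_def)

lemma prepend_column_in_tableaux:
  assumes S: "S \<in> tableaux n" and c: "c \<in> filled_columns n S"
  shows "prepend_column c S \<in> tableaux (Suc n)"
proof -
  have c1: "\<And>i. i \<noteq> Suc n \<Longrightarrow> i \<notin> free_rows n S \<Longrightarrow> c i = None"
    and c2: "\<And>i i'. c i = Some Alpha \<Longrightarrow> i' < i \<Longrightarrow> c i' = None"
    and c3: "c (Suc n) \<noteq> None"
    using c by (auto simp: filled_columns_def column_fillings_def)
  note D = tableauxD[OF S]
  show ?thesis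
    unfolding tableaux_def
  proof (intro CollectI conjI allI impI)
    fix p assume p: "p \<notin> staircase (Suc n)"
    obtain i j where ij: "p = (i, j)" by (cases p)
    consider "j = 0" | "j = 1" | k where "j = Suc (Suc k)"
      by (metis One_nat_def nat.exhaust)
    then show "prepend_column c S p = None"
    proof cases
      case 2
      then have "i \<notin> free_rows n S" "i \<noteq> Suc n"
        using p ij by (auto simp: staircase_def free_rows_def)
      then show ?thesis using c1 2 ij by simp
    next
      case 3
      then have "(i, Suc k) \<notin> staircase n" using p ij by (auto simp: staircase_def)
      then show ?thesis using D(1) ij 3 by simp
    qed (simp add: ij)
  next
    fix i j assume *: "(i, j) \<in> staircase (Suc n) \<and> i + j = Suc n + 1"
    consider "j = 0" | "j = 1" | k where "j = Suc (Suc k)"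
      by (metis One_nat_def nat.exhaust)
    then show "prepend_column c S (i, j) \<noteq> None"
    proof cases
      case 3
      then have "(i, Suc k) \<in> staircase n" "i + Suc k = n + 1" using * by (auto simp: staircase_def)
      then show ?thesis using D(2) 3 by simp
    qed (use * c3 in \<open>auto simp: staircase_def\<close>)
  next
    fix i j j' assume *: "prepend_column c S (i, j) = Some Beta \<and> j' < j"
    then obtain k where k: "j = Suc k" by (cases j) auto
    show "prepend_column c S (i, j') = None"
    proof (cases k)
      case 0 then show ?thesis using * k by simp
    next
      case (Suc l)
      then have b: "S (i, k) = Some Beta" using * k by simp
      then have "(i, k) \<in> staircase n" using D(1)[of i k] by fastforce
      then have "i \<noteq> Suc n" "i \<notin> free_rows n S"
        using b Suc by (auto simp: staircase_def free_rows_def)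
      then have "c i = None" by (rule c1)
      consider "j' = 0" | "j' = 1" | l' where "j' = Suc (Suc l')" "Suc l' < k"
        using * k by (cases j'; cases "j' - 1") auto
      then show ?thesis
        using \<open>c i = None\<close> D(3)[OF b] by cases auto
    qed
  next
    fix i i' j assume *: "prepend_column c S (i, j) = Some Alpha \<and> i' < i"
    consider "j = 0" | "j = 1" | k where "j = Suc (Suc k)"
      by (metis One_nat_def nat.exhaust)
    then show "prepend_column c S (i', j) = None"
      using * c2 D(4) by cases auto
  qed
qed

lemma drop_column_in_tableaux:
  assumes T: "T \<in> tableaux (Suc n)"
  shows "drop_column T \<in> tableaux n"
proof -
  note D = tableauxD[OF T]
  show ?thesis
    unfolding tableaux_def
  proof (intro CollectI conjI allI impI)
    fix p assume "p \<notin> staircase n"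
    then show "drop_column T p = None"
      by (cases p) (auto simp: drop_column_def staircase_def intro!: D(1))
  next
    fix i j assume "(i, j) \<in> staircase n \<and> i + j = n + 1"
    then show "drop_column T (i, j) \<noteq> None"
      using D(2)[of i "Suc j"] by (auto simp: drop_column_def staircase_def)
  next
    fix i j j' assume "drop_column T (i, j) = Some Beta \<and> j' < j"
    then show "drop_column T (i, j') = None"
      using D(3)[of i "Suc j" "Suc j'"] by (auto simp: drop_column_def split: if_splits)
  next
    fix i i' j assume "drop_column T (i, j) = Some Alpha \<and> i' < i"
    then show "drop_column T (i', j) = None"
      using D(4)[of i "Suc j" i'] by (auto simp: drop_column_def split: if_splits)
  qed
qed

lemma first_column_filled:
  assumes T: "T \<in> tableaux (Suc n)"
  shows "(\<lambda>i. T (i, 1)) \<in> filled_columns n (drop_column T)"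
proof -
  note D = tableauxD[OF T]
  have "T (i, 1) = None" if "i \<noteq> Suc n" "i \<notin> free_rows n (drop_column T)" for i
  proof (cases "i \<in> {1..n}")
    case True
    then have "\<not> (\<forall>j. drop_column T (i, j) \<noteq> Some Beta)"
      using that(2) unfolding free_rows_def by blast
    then obtain j where "drop_column T (i, j) = Some Beta" by blast
    then show ?thesis
      using D(3)[of i "Suc j" 1] by (auto simp: drop_column_def split: if_splits)
  next
    case False
    then show ?thesis using that by (intro D(1)) (auto simp: staircase_def)
  qed
  moreover have "T (Suc n, 1) \<noteq> None"
    by (rule D(2)) (auto simp: staircase_def)
  ultimately show ?thesis
    using D(4) by (auto simp: filled_columns_def column_fillings_def)
qed

lemma bij_betw_prepend_column:
  "bij_betw (\<lambda>(S, c). prepend_column c S)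
    (SIGMA S:tableaux n. filled_columns n S) (tableaux (Suc n))"
proof (rule bij_betw_byWitness[where f' = "\<lambda>T. (drop_column T, \<lambda>i. T (i, 1))"])
  show "\<forall>p\<in>SIGMA S:tableaux n. filled_columns n S.
      (\<lambda>T. (drop_column T, \<lambda>i. T (i, 1))) ((\<lambda>(S, c). prepend_column c S) p) = p"
  proof (intro ballI)
    fix p assume "p \<in> (SIGMA S:tableaux n. filled_columns n S)"
    then obtain S c where p: "p = (S, c)" and S: "S \<in> tableaux n" by blast
    have "drop_column (prepend_column c S) (i, j) = S (i, j)" for i j
      using tableaux_column_0[OF S] by (cases j) (auto simp: drop_column_def)
    then show "(\<lambda>T. (drop_column T, \<lambda>i. T (i, 1))) ((\<lambda>(S, c). prepend_column c S) p) = p"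
      by (auto simp: p)
  qed
  show "\<forall>T\<in>tableaux (Suc n).
      (\<lambda>(S, c). prepend_column c S) (drop_column T, \<lambda>i. T (i, 1)) = T"
  proof
    fix T assume T: "T \<in> tableaux (Suc n)"
    have "prepend_column (\<lambda>i. T (i, 1)) (drop_column T) (i, j) = T (i, j)" for i j
      using tableaux_column_0[OF T]
      by (cases j; cases "j - 1") (auto simp: drop_column_def)
    then show "(\<lambda>(S, c). prepend_column c S) (drop_column T, \<lambda>i. T (i, 1)) = T"
      by auto
  qed
qed (auto simp: prepend_column_in_tableaux drop_column_in_tableaux first_column_filled[simplified])

lemma finite_symbol_boxes:
  assumes "S \<in> tableaux n" shows "finite {p. S p = Some s}"
proof (rule finite_subset)
  show "{p. S p = Some s} \<subseteq> {..n} \<times> {..n}"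
  proof
    fix p assume "p \<in> {p. S p = Some s}"
    then have "p \<in> staircase n"
      using tableauxD(1)[OF assms, of "fst p" "snd p"] by auto
    then show "p \<in> {..n} \<times> {..n}" by (auto simp: staircase_def)
  qed
qed simp

lemma count_symbol_prepend_column:
  assumes S: "S \<in> tableaux n" and c: "c \<in> filled_columns n S"
  shows "count_symbol s (prepend_column c S) = card {i. c i = Some s} + count_symbol s S"
proof -
  have "{i. c i = Some s} \<subseteq> {..Suc n}"
    using c by (auto simp: filled_columns_def column_fillings_def free_rows_def)
       (metis atLeastAtMost_iff le_SucI le_refl option.distinct(1))
  then have fin: "finite {i. c i = Some s}" by (rule finite_subset) simp
  have eq: "{p. prepend_column c S p = Some s} =
      (\<lambda>i. (i, Suc 0)) ` {i. c i = Some s} \<union> (\<lambda>(i, j). (i, Suc j)) ` {p. S p = Some s}"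
    (is "?L = ?A \<union> ?B")
  proof
    show "?L \<subseteq> ?A \<union> ?B"
    proof
      fix p assume p: "p \<in> ?L"
      obtain i j where ij: "p = (i, j)" by (cases p)
      consider "j = 0" | "j = 1" | k where "j = Suc (Suc k)"
        by (metis One_nat_def nat.exhaust)
      then show "p \<in> ?A \<union> ?B"
      proof cases
        case 3
        then have "(i, j) = (\<lambda>(i, j). (i, Suc j)) (i, Suc k)" "S (i, Suc k) = Some s"
          using p ij by auto
        then show ?thesis using ij by blast
      qed (use p ij in auto)
    qed
    have "prepend_column c S (i, Suc j) = Some s" if "S (i, j) = Some s" for i j
      using that tableaux_column_0[OF S, of i] by (cases j) auto
    then show "?A \<union> ?B \<subseteq> ?L" by auto
  qed
  have disj: "?A \<inter> ?B = {}"
    using tableaux_column_0[OF S] by auto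
  have "card (?A \<union> ?B) = card ?A + card ?B"
    using fin finite_symbol_boxes[OF S] disj by (intro card_Un_disjoint) auto
  moreover have "card ?A = card {i. c i = Some s}"
    by (intro card_image) (auto simp: inj_on_def)
  moreover have "card ?B = card {p. S p = Some s}"
    by (intro card_image) (auto simp: inj_on_def)
  ultimately show ?thesis
    by (simp add: count_symbol_def eq)
qed

lemma free_rows_prepend_column:
  assumes S: "S \<in> tableaux n" and c: "c \<in> filled_columns n S"
  shows "free_rows (Suc n) (prepend_column c S) =
    {i \<in> insert (Suc n) (free_rows n S). c i \<noteq> Some Beta}"
proof -
  have row: "(\<forall>j. prepend_column c S (i, j) \<noteq> Some Beta) \<longleftrightarrow>
      c i \<noteq> Some Beta \<and> (\<forall>j. S (i, j) \<noteq> Some Beta)" for i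
  proof (intro iffI conjI allI)
    assume *: "\<forall>j. prepend_column c S (i, j) \<noteq> Some Beta"
    show "c i \<noteq> Some Beta" using *[rule_format, of "Suc 0"] by simp
    show "S (i, j) \<noteq> Some Beta" for j
      using *[rule_format, of "Suc j"] tableaux_column_0[OF S, of i] by (cases j) auto
  next
    fix j assume "c i \<noteq> Some Beta \<and> (\<forall>j. S (i, j) \<noteq> Some Beta)"
    then show "prepend_column c S (i, j) \<noteq> Some Beta"
      by (cases j; cases "j - 1") auto
  qed
  have "S (Suc n, j) = None" for j
    by (rule tableauxD(1)[OF S]) (auto simp: staircase_def)
  then show ?thesis
    by (auto simp: free_rows_def row le_Suc_eq)
qed

lemma prod_if_const:
  "finite G \<Longrightarrow> (\<Prod>i\<in>G. if Q i then x else 1) = (x::'a::comm_semiring_1) ^ card {i \<in> G. Q i}"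
  by (subst prod.inter_filter[symmetric]) auto

lemma prod_box_weight:
  fixes x y z :: "'a::comm_semiring_1"
  assumes "finite G" "c \<in> column_fillings G"
  shows "(\<Prod>i\<in>G. box_weight x y z (c i)) =
    x ^ card {i. c i = Some Alpha} * y ^ card {i. c i = Some Beta} * z ^ card {i \<in> G. c i \<noteq> Some Beta}"
proof -
  have "box_weight x y z s = (if s = Some Alpha then x else 1) * (if s = Some Beta then y else 1) *
      (if s \<noteq> Some Beta then z else 1)" for s
    by (cases s rule: symbol_option_cases) auto
  then have "(\<Prod>i\<in>G. box_weight x y z (c i)) =
      x ^ card {i \<in> G. c i = Some Alpha} * y ^ card {i \<in> G. c i = Some Beta} * z ^ card {i \<in> G. c i \<noteq> Some Beta}"
    using assms(1) by (simp only: prod.distrib prod_if_const)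
  moreover have "{i \<in> G. c i = Some s} = {i. c i = Some s}" for s
    using assms(2) by (auto simp: column_fillings_def)
  ultimately show ?thesis by simp
qed

text \<open>
  By \<open>filled_column_sum\<close>, summing over the first column replaces \<open>z ^ card (free_rows n S)\<close> by
  \<open>(x * z + y) * (y + z) ^ card (free_rows n S)\<close>, which is why the induction has to be done for all
  \<open>z\<close> simultaneously.
\<close>
lemma refined_generating_function:
  fixes x y z :: "'a::comm_semiring_1"
  shows "(\<Sum>S\<in>tableaux n. x ^ count_symbol Alpha S * y ^ count_symbol Beta S * z ^ card (free_rows n S)) =
    (\<Prod>i<n. x * (z + of_nat i * y) + y)"
proof (induction n arbitrary: z)
  case 0
  have "p \<notin> staircase 0" for p
    by (auto simp: staircase_def)
  then have "S = (\<lambda>_. None)" if "S \<in> tableaux 0" for S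
    using that unfolding tableaux_def by blast
  then have "tableaux 0 = {\<lambda>_. None}"
    using tableaux_nonempty[of 0] by blast
  then show ?case by (simp add: count_symbol_def free_rows_def)
next
  case (Suc n)
  let ?w = "\<lambda>S. x ^ count_symbol Alpha S * y ^ count_symbol Beta S"
  let ?G = "\<lambda>S. insert (Suc n) (free_rows n S)"
  have fin: "finite (free_rows n S)" and below: "\<forall>i\<in>free_rows n S. i < Suc n" for S
    by (auto simp: free_rows_def)
  have finc: "finite (filled_columns n S)" for S
    unfolding filled_columns_def by (rule finite_Collect_conjI) (simp add: finite_column_fillings fin)
  have "(\<Sum>T\<in>tableaux (Suc n). ?w T * z ^ card (free_rows (Suc n) T)) =
      (\<Sum>(S, c)\<in>(SIGMA S:tableaux n. filled_columns n S).
        ?w (prepend_column c S) * z ^ card (free_rows (Suc n) (prepend_column c S)))"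
    by (subst sum.reindex_bij_betw[OF bij_betw_prepend_column, symmetric])
      (simp add: case_prod_unfold)
  also have "\<dots> = (\<Sum>S\<in>tableaux n. \<Sum>c\<in>filled_columns n S.
        ?w (prepend_column c S) * z ^ card (free_rows (Suc n) (prepend_column c S)))"
    by (subst sum.Sigma) (auto simp: finite_tableaux finc)
  also have "\<dots> = (\<Sum>S\<in>tableaux n. \<Sum>c\<in>filled_columns n S.
        ?w S * (\<Prod>i\<in>?G S. box_weight x y z (c i)))"
  proof (intro sum.cong refl)
    fix S c assume S: "S \<in> tableaux n" and c: "c \<in> filled_columns n S"
    have "c \<in> column_fillings (?G S)" using c by (simp add: filled_columns_def)
    then show "?w (prepend_column c S) * z ^ card (free_rows (Suc n) (prepend_column c S)) =
        ?w S * (\<Prod>i\<in>?G S. box_weight x y z (c i))"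
      using prod_box_weight[of "?G S" c x y z] fin
      by (simp add: count_symbol_prepend_column[OF S c] free_rows_prepend_column[OF S c]
          power_add mult_ac)
  qed
  also have "\<dots> = (\<Sum>S\<in>tableaux n. ?w S * ((x * z + y) * (y + z) ^ card (free_rows n S)))"
    by (simp only: filled_columns_def sum_distrib_left[symmetric] filled_column_sum[OF fin below])
  also have "\<dots> = (x * z + y) * (\<Sum>S\<in>tableaux n. ?w S * (y + z) ^ card (free_rows n S))"
    by (simp add: sum_distrib_left mult_ac)
  also have "\<dots> = (x * z + y) * (\<Prod>i<n. x * (y + z + of_nat i * y) + y)"
    by (simp add: Suc)
  also have "\<dots> = (\<Prod>i<Suc n. x * (z + of_nat i * y) + y)"
    unfolding prod.lessThan_Suc_shift by (simp add: algebra_simps)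
  finally show ?case .
qed

lemma generating_function:
  fixes x y :: "'a::comm_semiring_1"
  shows "(\<Sum>S\<in>tableaux n. x ^ count_symbol Alpha S * y ^ count_symbol Beta S) =
    (\<Prod>i<n. x + y + of_nat i * (x * y))"
  using refined_generating_function[where z = "1::'a"] by (simp add: algebra_simps)

section \<open>The law of the symbol counts\<close>

text \<open>
  The probability that step \<open>i\<close> misses the symbol belonging to the first argument. The denominator
  vanishes only if \<open>a = b = 0\<close> and \<open>i = 0\<close>; the value \<open>1 / 2\<close> is then the limit along
  \<open>\<alpha> = \<beta> \<rightarrow> \<infinity>\<close>.
\<close>
definition share :: "real \<Rightarrow> real \<Rightarrow> nat \<Rightarrow> real" where
  "share a b i = (if a + b + real i = 0 then 1 / 2 else a / (a + b + real i))"

lemma tendsto_share: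
  assumes f: "(f \<longlongrightarrow> a) F" and g: "(g \<longlongrightarrow> b) F"
    and pos: "eventually (\<lambda>x. f x > 0 \<and> g x > 0) F"
    and deg: "a + b = 0 \<Longrightarrow> f = g" and nn: "a \<ge> 0" "b \<ge> 0"
  shows "((\<lambda>x. share (f x) (g x) i) \<longlongrightarrow> share a b i) F"
proof (cases "a + b + real i = 0")
  case True
  then have i: "i = 0" and fg: "f = g" using nn deg by auto
  have "eventually (\<lambda>x. share (f x) (g x) i = 1 / 2) F"
    using pos by eventually_elim (simp add: share_def i fg)
  then show ?thesis
    using True by (simp add: share_def tendsto_eventually)
next
  case False
  have "((\<lambda>x. f x / (f x + g x + real i)) \<longlongrightarrow> a / (a + b + real i)) F"
    by (intro tendsto_intros f g False)
  moreover have "eventually (\<lambda>x. f x / (f x + g x + real i) = share (f x) (g x) i) F"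
    using pos by eventually_elim (auto simp: share_def)
  ultimately show ?thesis
    using False by (simp add: share_def Lim_transform_eventually)
qed

lemma finite_prob_generating_function:
  fixes s t :: "'a::real_normed_field"
  assumes "x > 0" "y > 0"
  shows "(\<Sum>S\<in>tableaux n. of_real (finite_prob n x y S) * s ^ count_symbol Alpha S * t ^ count_symbol Beta S) =
    (\<Prod>i<n. of_real (share (1/y) (1/x) i) * s + of_real (share (1/x) (1/y) i) * t +
      of_real (1 - share (1/x) (1/y) i - share (1/y) (1/x) i) * (s * t))"
proof -
  let ?d = "\<lambda>i. x + y + real i * (x * y)"
  have d: "?d i > 0" for i using assms by (simp add: add_pos_nonneg)
  have Z: "partition_fun n x y = prod ?d {..<n}"
    using generating_function[of x y n] by (simp add: partition_fun_def weight_def)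
  have share: "share (1/x) (1/y) i = y / ?d i" "share (1/y) (1/x) i = x / ?d i" for i
  proof -
    have "1/x + 1/y + real i = ?d i / (x * y)" "1/y + 1/x + real i = ?d i / (x * y)"
      using assms by (simp_all add: field_simps)
    moreover have "?d i / (x * y) \<noteq> 0" using d[of i] assms by simp
    ultimately have "share (1/x) (1/y) i = (1/x) / (?d i / (x * y))"
      "share (1/y) (1/x) i = (1/y) / (?d i / (x * y))"
      by (simp_all only: share_def if_False)
    then show "share (1/x) (1/y) i = y / ?d i" "share (1/y) (1/x) i = x / ?d i"
      using assms by simp_all
  qed
  have "(\<Sum>S\<in>tableaux n. of_real (finite_prob n x y S) * s ^ count_symbol Alpha S * t ^ count_symbol Beta S) =
      (\<Sum>S\<in>tableaux n. (of_real x * s) ^ count_symbol Alpha S * (of_real y * t) ^ count_symbol Beta S)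
        / of_real (partition_fun n x y)"
    unfolding sum_divide_distrib
    by (intro sum.cong refl) (simp add: finite_prob_def weight_def power_mult_distrib)
  also have "\<dots> = (\<Prod>i<n. of_real x * s + of_real y * t + of_nat i * (of_real x * s * (of_real y * t)))
      / (\<Prod>i<n. of_real (?d i))"
    by (simp only: generating_function Z of_real_prod)
  also have "\<dots> = (\<Prod>i<n. (of_real x * s + of_real y * t + of_nat i * (of_real x * s * (of_real y * t)))
      / of_real (?d i))"
    by (simp only: prod_dividef)
  also have "\<dots> = (\<Prod>i<n. of_real (share (1/y) (1/x) i) * s + of_real (share (1/x) (1/y) i) * t +
      of_real (1 - share (1/x) (1/y) i - share (1/y) (1/x) i) * (s * t))"
  proof (intro prod.cong refl)
    fix i
    have "1 - y / ?d i - x / ?d i = real i * (x * y) / ?d i"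
    proof -
      have "?d i / ?d i = 1" using d[of i] by simp
      then show ?thesis unfolding add_divide_distrib by linarith
    qed
    moreover have "of_real (?d i) \<noteq> (0::'a)" using d[of i] by (simp only: of_real_eq_0_iff)
    ultimately show "(of_real x * s + of_real y * t + of_nat i * (of_real x * s * (of_real y * t))) / of_real (?d i) =
      of_real (share (1/y) (1/x) i) * s + of_real (share (1/x) (1/y) i) * t +
      of_real (1 - share (1/x) (1/y) i - share (1/y) (1/x) i) * (s * t)"
      unfolding share by (simp only: of_real_divide of_real_mult of_real_of_nat_eq times_divide_eq_left
        times_divide_eq_right add_divide_distrib mult_ac)
  qed
  finally show ?thesis .
qed

text \<open>
  The expansion of \<open>s ^ N\<close> in powers of \<open>s - 1\<close> has the binomial coefficients of \<open>N\<close> as coefficients,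
  so the first two factorial moments can be compared with the coefficients of the product.
\<close>
lemma moments_of_quadratic_product:
  fixes w :: "'a \<Rightarrow> real" and N :: "'a \<Rightarrow> nat" and c d :: "nat \<Rightarrow> real"
  assumes "\<And>s. (\<Sum>S\<in>A. w S * s ^ N S) = (\<Prod>i<n. 1 + c i * (s - 1) + d i * (s - 1)\<^sup>2)"
  shows "(\<Sum>S\<in>A. w S * real (N S)) = (\<Sum>i<n. c i)"
    and "(\<Sum>S\<in>A. w S * (real (N S) * (real (N S) - 1))) =
      2 * (\<Sum>i<n. d i) + (\<Sum>i<n. c i)\<^sup>2 - (\<Sum>i<n. (c i)\<^sup>2)"
proof -
  \<comment> \<open>both sides as polynomials in the variable \<open>h = s - 1\<close>\<close>
  define L where "L = (\<Sum>S\<in>A. smult (w S) ([:1, 1:] ^ N S))"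
  define R where "R = (\<lambda>n. \<Prod>i<n. [:1, c i, d i:])"
  have "poly L h = poly (R n) h" for h
    using assms[of "1 + h"]
    by (simp add: L_def R_def poly_sum poly_prod algebra_simps power2_eq_square)
  then have LR: "L = R n"
    by (simp add: poly_eq_poly_eq_iff[symmetric] fun_eq_iff)
  have L: "coeff L k = (\<Sum>S\<in>A. w S * real (N S choose k))" for k
  proof -
    have "coeff ([:1, 1:] ^ m) k = (of_nat (m choose k) :: real)" for m
      by (cases "k \<le> m") (simp_all add: coeff_linear_poly_power coeff_eq_0 degree_linear_power binomial_eq_0)
    then show ?thesis by (simp add: L_def coeff_sum)
  qed
  have "coeff (R m) 0 = 1 \<and> coeff (R m) 1 = (\<Sum>i<m. c i) \<and>
      2 * coeff (R m) 2 = 2 * (\<Sum>i<m. d i) + (\<Sum>i<m. c i)\<^sup>2 - (\<Sum>i<m. (c i)\<^sup>2)" for m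
  proof (induction m)
    case (Suc m)
    have R: "R (Suc m) = R m * [:1, c m, d m:]" by (simp add: R_def)
    show ?case
      using Suc unfolding R
      by (simp add: coeff_mult numeral_2_eq_2 atMost_Suc algebra_simps power2_eq_square)
  qed (simp add: R_def)
  then have R: "coeff (R n) 1 = (\<Sum>i<n. c i)"
    "2 * coeff (R n) 2 = 2 * (\<Sum>i<n. d i) + (\<Sum>i<n. c i)\<^sup>2 - (\<Sum>i<n. (c i)\<^sup>2)" by auto
  show "(\<Sum>S\<in>A. w S * real (N S)) = (\<Sum>i<n. c i)"
    using R(1) LR L[of 1] by simp
  have "2 * real (m choose 2) = real m * (real m - 1)" for m
    by (cases m) (simp_all add: choose_two of_nat_diff algebra_simps real_of_nat_div)
  then have "(\<Sum>S\<in>A. w S * (real (N S) * (real (N S) - 1))) = (\<Sum>S\<in>A. 2 * (w S * real (N S choose 2)))"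
    by (intro sum.cong) (auto simp only: mult.left_commute)
  then show "(\<Sum>S\<in>A. w S * (real (N S) * (real (N S) - 1))) =
      2 * (\<Sum>i<n. d i) + (\<Sum>i<n. c i)\<^sup>2 - (\<Sum>i<n. (c i)\<^sup>2)"
    using R(2) LR L[of 2] by (simp add: sum_distrib_left)
qed

lemma share_nonneg: "a \<ge> 0 \<Longrightarrow> b \<ge> 0 \<Longrightarrow> share a b i \<ge> 0"
  by (simp add: share_def)

lemma share_add_le_1: "a \<ge> 0 \<Longrightarrow> b \<ge> 0 \<Longrightarrow> share a b i + share b a i \<le> 1"
  by (auto simp: share_def add_ac add_divide_distrib[symmetric] divide_le_eq_1)

lemma share_le: "a \<ge> 0 \<Longrightarrow> b \<ge> 0 \<Longrightarrow> i \<ge> 1 \<Longrightarrow> share a b i \<le> a / real i"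
  by (auto simp: share_def intro!: divide_left_mono mult_pos_pos)

lemma convergent_imp_bigo_1:
  assumes "convergent (X :: nat \<Rightarrow> real)" shows "X \<in> O(\<lambda>_. 1)"
proof -
  obtain K where "\<And>n. norm (X n) \<le> K"
    using convergent_imp_Bseq[OF assms] by (auto simp: Bseq_def)
  then show ?thesis by (intro bigoI[where c = K]) simp
qed

lemma bounded_partial_sums:
  fixes f :: "nat \<Rightarrow> real"
  assumes "\<And>i. i \<ge> 1 \<Longrightarrow> \<bar>f i\<bar> \<le> C / (real i)\<^sup>2"
  shows "(\<lambda>n. \<Sum>i<n. f i) \<in> O(\<lambda>_. 1)"
proof -
  have "summable (\<lambda>i. C * inverse (real i ^ 2))"
    using inverse_power_summable[of 2, where 'a = real] by (intro summable_mult) simp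
  then have "summable f"
    by (rule summable_comparison_test'[where N = 1])
      (use assms in \<open>simp add: divide_inverse\<close>)
  then show ?thesis
    by (intro convergent_imp_bigo_1) (simp add: summable_iff_convergent)
qed

text \<open>
  The difference between \<open>share a b i\<close> and \<open>a / (i + 1)\<close> is of order \<open>1 / i\<^sup>2\<close>, and the harmonic
  numbers differ from the logarithm by a convergent sequence.
\<close>
lemma sum_share_asymp:
  assumes "a \<ge> 0" "b \<ge> 0"
  shows "(\<lambda>n. (\<Sum>i<n. share a b i) - a * ln (real n)) \<in> O(\<lambda>_. 1)"
proof -
  have "(\<lambda>n. \<Sum>i<n. share a b i - a / real (Suc i)) \<in> O(\<lambda>_. 1)"
  proof (rule bounded_partial_sums[where C = "a * \<bar>1 - a - b\<bar>"])
    fix i :: nat assume i: "i \<ge> 1"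
    then have pos: "a + b + real i > 0" using assms by simp
    have "share a b i - a / real (Suc i) = a * (1 - a - b) / ((a + b + real i) * real (Suc i))"
      using pos by (simp add: share_def field_simps)
    then have "\<bar>share a b i - a / real (Suc i)\<bar> = a * \<bar>1 - a - b\<bar> / ((a + b + real i) * real (Suc i))"
      using pos assms by (simp add: abs_mult)
    also have "\<dots> \<le> a * \<bar>1 - a - b\<bar> / (real i)\<^sup>2"
      using i pos assms unfolding power2_eq_square
      by (intro divide_left_mono mult_mono mult_pos_pos mult_nonneg_nonneg) auto
    finally show "\<bar>share a b i - a / real (Suc i)\<bar> \<le> a * \<bar>1 - a - b\<bar> / (real i)\<^sup>2" .
  qed
  moreover have "(\<lambda>n. a * (harm n - ln (real n))) \<in> O(\<lambda>_. 1)"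
    using euler_mascheroni_convergent by (intro convergent_imp_bigo_1 convergent_mult convergent_const)
  ultimately have "(\<lambda>n. (\<Sum>i<n. share a b i - a / real (Suc i)) + a * (harm n - ln (real n))) \<in> O(\<lambda>_. 1)"
    by (rule sum_in_bigo)
  moreover have "(\<Sum>i<n. share a b i - a / real (Suc i)) + a * (harm n - ln (real n)) =
      (\<Sum>i<n. share a b i) - a * ln (real n)" for n
    by (simp add: sum_subtractf harm_altdef sum_distrib_left right_diff_distrib divide_inverse)
  ultimately show ?thesis by simp
qed

lemma sum_share_mult_bounded:
  assumes "a \<ge> 0" "b \<ge> 0" "c \<ge> 0" "d \<ge> 0"
  shows "(\<lambda>n. \<Sum>i<n. share a b i * share c d i) \<in> O(\<lambda>_. 1)"
proof (rule bounded_partial_sums[where C = "a * c"])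
  fix i :: nat assume i: "i \<ge> 1"
  have "share a b i * share c d i \<le> (a / real i) * (c / real i)"
    using assms i by (intro mult_mono share_le share_nonneg) auto
  then show "\<bar>share a b i * share c d i\<bar> \<le> a * c / (real i)\<^sup>2"
    using assms by (simp add: share_nonneg power2_eq_square)
qed

locale random_staircase_tableau =
  fixes \<alpha> \<beta> :: ennreal and a b :: real
  assumes params_pos: "\<alpha> > 0" "\<beta> > 0"
    and a_def: "a = enn2real (inverse \<alpha>)" and b_def: "b = enn2real (inverse \<beta>)"
begin

lemma nonneg: "a \<ge> 0" "b \<ge> 0"
  by (simp_all add: a_def b_def)

abbreviation p :: "nat \<Rightarrow> real" where "p \<equiv> share a b"
abbreviation q :: "nat \<Rightarrow> real" where "q \<equiv> share b a"
abbreviation PT :: "nat \<Rightarrow> filling pmf" where "PT n \<equiv> tableau_pmf n \<alpha> \<beta>"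

lemma pq: "p i \<ge> 0" "q i \<ge> 0" "p i + q i \<le> 1"
  by (simp_all add: nonneg share_nonneg share_add_le_1)

text \<open>
  Uniform access to the four cases of finite and infinite parameters. The last conjunct records that
  both parameters tend to infinity along the diagonal, on which the degenerate value of \<open>share\<close>
  depends.
\<close>
lemma finite_parameter_limit:
  "\<exists>u v :: real \<Rightarrow> real. (\<forall>x>0. u x > 0 \<and> v x > 0) \<and>
    (\<forall>n S. ((\<lambda>x. finite_prob n (u x) (v x) S) \<longlongrightarrow> tableau_prob n \<alpha> \<beta> S) at_top) \<and>
    ((\<lambda>x. 1 / u x) \<longlongrightarrow> a) at_top \<and> ((\<lambda>x. 1 / v x) \<longlongrightarrow> b) at_top \<and> (a + b = 0 \<longrightarrow> u = v)"
proof -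
  note lims = tendsto_tableau_prob[OF params_pos]
  have inv0: "((\<lambda>x::real. 1 / x) \<longlongrightarrow> 0) at_top"
    using tendsto_inverse_0_at_top[OF filterlim_ident] by (simp add: inverse_eq_divide)
  have inv: "enn2real (inverse c) = 1 / enn2real c \<and> enn2real c > 0" if "c > 0" "c \<noteq> \<infinity>" for c :: ennreal
  proof -
    have "c = ennreal (enn2real c)" "enn2real c > 0"
      using that enn2real_pos by (simp_all add: top.not_eq_extremum)
    then show ?thesis
      by (metis enn2real_ennreal enn2real_nonneg inverse_ennreal inverse_eq_divide
          divide_nonneg_nonneg zero_le_one)
  qed
  consider "\<alpha> = \<infinity>" "\<beta> = \<infinity>" | "\<alpha> = \<infinity>" "\<beta> \<noteq> \<infinity>" | "\<alpha> \<noteq> \<infinity>" "\<beta> = \<infinity>" | "\<alpha> \<noteq> \<infinity>" "\<beta> \<noteq> \<infinity>"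
    by blast
  then show ?thesis
  proof cases
    case 1
    then show ?thesis
      using lims(3) inv0 by (intro exI[of _ "\<lambda>x. x"] exI[of _ "\<lambda>x. x"]) (simp_all add: a_def b_def)
  next
    case 2
    then show ?thesis
      using lims(1) inv0 inv[OF params_pos(2)]
      by (intro exI[of _ "\<lambda>x. x"] exI[of _ "\<lambda>_. enn2real \<beta>"]) (simp_all add: a_def b_def)
  next
    case 3
    then show ?thesis
      using lims(2) inv0 inv[OF params_pos(1)]
      by (intro exI[of _ "\<lambda>_. enn2real \<alpha>"] exI[of _ "\<lambda>x. x"]) (simp_all add: a_def b_def)
  next
    case 4
    then have "1 / enn2real \<alpha> + 1 / enn2real \<beta> > 0"
      using inv[OF params_pos(1)] inv[OF params_pos(2)] by (intro add_pos_pos) auto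
    with 4 show ?thesis
      using inv[OF params_pos(1)] inv[OF params_pos(2)]
      by (intro exI[of _ "\<lambda>_. enn2real \<alpha>"] exI[of _ "\<lambda>_. enn2real \<beta>"])
        (simp_all add: a_def b_def tableau_prob_def)
  qed
qed

text \<open>
  For finite parameters this is the generating function divided by its value at \<open>s = t = 1\<close>. Complex
  arguments give the joint characteristic function, real ones the moments.
\<close>
lemma probability_generating_function:
  fixes s t :: "'a::{real_normed_field}"
  shows "(\<Sum>S\<in>tableaux n. of_real (tableau_prob n \<alpha> \<beta> S) * s ^ count_symbol Alpha S * t ^ count_symbol Beta S) =
    (\<Prod>i<n. of_real (q i) * s + of_real (p i) * t + of_real (1 - p i - q i) * (s * t))"
proof -
  obtain u v :: "real \<Rightarrow> real" where pos: "\<And>x. x > 0 \<Longrightarrow> u x > 0 \<and> v x > 0"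
    and lim: "\<And>n S. ((\<lambda>x. finite_prob n (u x) (v x) S) \<longlongrightarrow> tableau_prob n \<alpha> \<beta> S) at_top"
    and u: "((\<lambda>x. 1 / u x) \<longlongrightarrow> a) at_top" and v: "((\<lambda>x. 1 / v x) \<longlongrightarrow> b) at_top"
    and deg: "a + b = 0 \<Longrightarrow> u = v"
    using finite_parameter_limit by blast
  have ev: "eventually (\<lambda>x. u x > 0 \<and> v x > 0) at_top"
    using eventually_gt_at_top[of 0] by eventually_elim (rule pos)
  have "eventually (\<lambda>x. 1 / u x > 0 \<and> 1 / v x > 0) at_top"
    "eventually (\<lambda>x. 1 / v x > 0 \<and> 1 / u x > 0) at_top"
    using ev by (eventually_elim, simp)+
  then have share: "((\<lambda>x. share (1 / u x) (1 / v x) i) \<longlongrightarrow> p i) at_top"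
    "((\<lambda>x. share (1 / v x) (1 / u x) i) \<longlongrightarrow> q i) at_top" for i
    using u v deg nonneg by (auto intro!: tendsto_share simp: add.commute)
  let ?L = "\<lambda>x. \<Sum>S\<in>tableaux n. of_real (finite_prob n (u x) (v x) S) * s ^ count_symbol Alpha S * t ^ count_symbol Beta S"
  let ?R = "\<lambda>x. \<Prod>i<n. of_real (share (1 / v x) (1 / u x) i) * s + of_real (share (1 / u x) (1 / v x) i) * t +
      of_real (1 - share (1 / u x) (1 / v x) i - share (1 / v x) (1 / u x) i) * (s * t)"
  have L: "(?L \<longlongrightarrow> (\<Sum>S\<in>tableaux n. of_real (tableau_prob n \<alpha> \<beta> S) * s ^ count_symbol Alpha S * t ^ count_symbol Beta S)) at_top"
    by (intro tendsto_intros lim)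
  have R: "(?R \<longlongrightarrow> (\<Prod>i<n. of_real (q i) * s + of_real (p i) * t + of_real (1 - p i - q i) * (s * t))) at_top"
    by (intro tendsto_intros share)
  have "eventually (\<lambda>x. ?R x = ?L x) at_top"
    using ev by eventually_elim (simp only: finite_prob_generating_function)
  with R have "(?L \<longlongrightarrow> (\<Prod>i<n. of_real (q i) * s + of_real (p i) * t + of_real (1 - p i - q i) * (s * t))) at_top"
    by (rule Lim_transform_eventually)
  from tendsto_unique[OF trivial_limit_at_top_linorder L this] show ?thesis .
qed

lemma set_PT: "set_pmf (PT n) \<subseteq> tableaux n"
  using tableau_prob_outside[OF params_pos, where n = n]
  by (fastforce simp: set_pmf_iff pmf_tableau_pmf[OF params_pos])

lemma integrable_PT [simp]: "integrable (PT n) (f :: filling \<Rightarrow> 'b::{banach, second_countable_topology})"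
  using finite_subset[OF set_PT finite_tableaux] by (rule integrable_measure_pmf_finite)

lemma expectation_PT:
  fixes f :: "filling \<Rightarrow> 'b::{banach, second_countable_topology}"
  shows "measure_pmf.expectation (PT n) f = (\<Sum>S\<in>tableaux n. tableau_prob n \<alpha> \<beta> S *\<^sub>R f S)"
  using set_PT by (subst integral_measure_pmf[OF finite_tableaux[of n]]) (auto simp: pmf_tableau_pmf[OF params_pos])

text \<open>
  The shape \<open>1 + c (s - 1) + d (s - 1)\<^sup>2\<close> covers each count alone, with \<open>d = 0\<close>, and also the total
  number of symbols, from which the covariance is obtained by polarization.
\<close>
lemma moments_PT:
  fixes N :: "filling \<Rightarrow> nat"
  assumes "\<And>s::real. (\<Sum>S\<in>tableaux n. tableau_prob n \<alpha> \<beta> S * s ^ N S) =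
    (\<Prod>i<n. 1 + c i * (s - 1) + d i * (s - 1)\<^sup>2)"
  shows "measure_pmf.expectation (PT n) (\<lambda>S. real (N S)) = (\<Sum>i<n. c i)"
    and "measure_pmf.variance (PT n) (\<lambda>S. real (N S)) = (\<Sum>i<n. c i - (c i)\<^sup>2 + 2 * d i)"
proof -
  note m = moments_of_quadratic_product[OF assms]
  show mean: "measure_pmf.expectation (PT n) (\<lambda>S. real (N S)) = (\<Sum>i<n. c i)"
    using m(1) by (simp add: expectation_PT)
  have "measure_pmf.expectation (PT n) (\<lambda>S. real (N S) * (real (N S) - 1)) =
      2 * (\<Sum>i<n. d i) + (\<Sum>i<n. c i)\<^sup>2 - (\<Sum>i<n. (c i)\<^sup>2)"
    using m(2) by (simp add: expectation_PT)
  moreover have "measure_pmf.expectation (PT n) (\<lambda>S. (real (N S))\<^sup>2) =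
      measure_pmf.expectation (PT n) (\<lambda>S. real (N S) * (real (N S) - 1) + real (N S))"
    by (simp add: algebra_simps power2_eq_square)
  ultimately have "measure_pmf.expectation (PT n) (\<lambda>S. (real (N S))\<^sup>2) =
      2 * (\<Sum>i<n. d i) + (\<Sum>i<n. c i)\<^sup>2 - (\<Sum>i<n. (c i)\<^sup>2) + (\<Sum>i<n. c i)"
    using mean by (simp only: Bochner_Integration.integral_add[OF integrable_PT integrable_PT])
  then show "measure_pmf.variance (PT n) (\<lambda>S. real (N S)) = (\<Sum>i<n. c i - (c i)\<^sup>2 + 2 * d i)"
    by (subst measure_pmf.variance_eq)
      (simp_all add: mean sum.distrib sum_subtractf sum_distrib_left)
qed

lemma pgf_alpha:
  "(\<Sum>S\<in>tableaux n. tableau_prob n \<alpha> \<beta> S * s ^ count_symbol Alpha S) =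
    (\<Prod>i<n. 1 + (1 - p i) * (s - 1) + 0 * (s - 1)\<^sup>2)" for s :: real
  using probability_generating_function[of n s "1::real"] by (simp add: algebra_simps)

lemma pgf_beta:
  "(\<Sum>S\<in>tableaux n. tableau_prob n \<alpha> \<beta> S * s ^ count_symbol Beta S) =
    (\<Prod>i<n. 1 + (1 - q i) * (s - 1) + 0 * (s - 1)\<^sup>2)" for s :: real
  using probability_generating_function[of n "1::real" s] by (simp add: algebra_simps)

lemma pgf_sum:
  "(\<Sum>S\<in>tableaux n. tableau_prob n \<alpha> \<beta> S * s ^ (count_symbol Alpha S + count_symbol Beta S)) =
    (\<Prod>i<n. 1 + (2 - p i - q i) * (s - 1) + (1 - p i - q i) * (s - 1)\<^sup>2)" for s :: real
  using probability_generating_function[of n s s]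
  by (simp add: power_add algebra_simps power2_eq_square)

lemma mean_alpha: "measure_pmf.expectation (PT n) N_alpha = (\<Sum>i<n. 1 - p i)"
  using moments_PT(1)[OF pgf_alpha] unfolding N_alpha_def .

lemma mean_beta: "measure_pmf.expectation (PT n) N_beta = (\<Sum>i<n. 1 - q i)"
  using moments_PT(1)[OF pgf_beta] unfolding N_beta_def .

lemma var_alpha: "measure_pmf.variance (PT n) N_alpha = (\<Sum>i<n. p i * (1 - p i))"
  using moments_PT(2)[OF pgf_alpha] unfolding N_alpha_def
  by (simp add: algebra_simps power2_eq_square)

lemma var_beta: "measure_pmf.variance (PT n) N_beta = (\<Sum>i<n. q i * (1 - q i))"
  using moments_PT(2)[OF pgf_beta] unfolding N_beta_def
  by (simp add: algebra_simps power2_eq_square)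

lemma covariance_alpha_beta: "covariance (PT n) N_alpha N_beta = - (\<Sum>i<n. p i * q i)"
proof -
  let ?E = "measure_pmf.expectation (PT n)"
  let ?X = "\<lambda>S. N_alpha S - ?E N_alpha" and ?Y = "\<lambda>S. N_beta S - ?E N_beta"
  have sum: "real (count_symbol Alpha S + count_symbol Beta S) = N_alpha S + N_beta S" for S
    by (simp add: N_alpha_def N_beta_def)
  have "?E (\<lambda>S. (N_alpha S + N_beta S - ?E (\<lambda>S. N_alpha S + N_beta S))\<^sup>2) =
      (\<Sum>i<n. (2 - p i - q i) - (2 - p i - q i)\<^sup>2 + 2 * (1 - p i - q i))"
    using moments_PT(2)[OF pgf_sum] unfolding sum .
  moreover have "?E (\<lambda>S. N_alpha S + N_beta S) = ?E N_alpha + ?E N_beta"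
    by (rule Bochner_Integration.integral_add) simp_all
  moreover have "(N_alpha S + N_beta S - (?E N_alpha + ?E N_beta))\<^sup>2 = ((?X S)\<^sup>2 + (?Y S)\<^sup>2) + 2 * (?X S * ?Y S)" for S
    by (simp add: power2_eq_square algebra_simps)
  ultimately have "?E (\<lambda>S. ((?X S)\<^sup>2 + (?Y S)\<^sup>2) + 2 * (?X S * ?Y S)) =
      (\<Sum>i<n. (2 - p i - q i) - (2 - p i - q i)\<^sup>2 + 2 * (1 - p i - q i))" by simp
  then have "(\<Sum>i<n. p i * (1 - p i)) + (\<Sum>i<n. q i * (1 - q i)) + 2 * covariance (PT n) N_alpha N_beta =
      (\<Sum>i<n. (2 - p i - q i) - (2 - p i - q i)\<^sup>2 + 2 * (1 - p i - q i))"
    unfolding covariance_def var_alpha[symmetric] var_beta[symmetric]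
    by (simp only: Bochner_Integration.integral_add[OF integrable_PT integrable_PT]
        integral_mult_right_zero)
  moreover have "(\<Sum>i<n. (2 - p i - q i) - (2 - p i - q i)\<^sup>2 + 2 * (1 - p i - q i)) =
      (\<Sum>i<n. p i * (1 - p i)) + (\<Sum>i<n. q i * (1 - q i)) + 2 * (- (\<Sum>i<n. p i * q i))"
    unfolding sum_distrib_left sum_negf[symmetric] sum.distrib[symmetric]
    by (intro sum.cong refl) (simp add: algebra_simps power2_eq_square)
  ultimately show ?thesis by linarith
qed

lemma mean_alpha_asymp:
  "(\<lambda>n. measure_pmf.expectation (PT n) N_alpha - (real n - a * ln (real n))) \<in> O(\<lambda>_. 1)"
proof -
  have "(\<lambda>n. - ((\<Sum>i<n. p i) - a * ln (real n))) \<in> O(\<lambda>_. 1)"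
    using sum_share_asymp[OF nonneg] by (simp only: landau_o.big.uminus_in_iff)
  then show ?thesis by (simp add: mean_alpha sum_subtractf algebra_simps)
qed

lemma variance_asymp:
  "(\<lambda>n. measure_pmf.variance (PT n) N_alpha - a * ln (real n)) \<in> O(\<lambda>_. 1)"
  "(\<lambda>n. measure_pmf.variance (PT n) N_beta - b * ln (real n)) \<in> O(\<lambda>_. 1)"
proof -
  have "(\<lambda>n. ((\<Sum>i<n. share c d i) - c * ln (real n)) - (\<Sum>i<n. share c d i * share c d i)) \<in> O(\<lambda>_. 1)"
    if "c \<ge> 0" "d \<ge> 0" for c d
    using sum_share_asymp[OF that] sum_share_mult_bounded[OF that that] by (rule sum_in_bigo)
  from this[of a b] this[of b a] nonneg
  show "(\<lambda>n. measure_pmf.variance (PT n) N_alpha - a * ln (real n)) \<in> O(\<lambda>_. 1)"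
    "(\<lambda>n. measure_pmf.variance (PT n) N_beta - b * ln (real n)) \<in> O(\<lambda>_. 1)"
    unfolding var_alpha var_beta by (simp_all add: sum_subtractf algebra_simps)
qed

lemma covariance_bounded: "(\<lambda>n. covariance (PT n) N_alpha N_beta) \<in> O(\<lambda>_. 1)"
  unfolding covariance_alpha_beta
  using sum_share_mult_bounded[of a b b a] nonneg by (simp only: landau_o.big.uminus_in_iff)

end

section \<open>Levy continuity for product limits in the plane\<close>

text \<open>
  Levy's theorem for the laws of \<open>X n\<close> under the probability measures with density proportional to
  \<open>W n\<close>. The total masses converge to \<open>w\<close> (take \<open>u = 0\<close>), so these measures exist for all large
  \<open>n\<close>.
\<close>
lemma weighted_levy_continuity:
  fixes M :: "nat \<Rightarrow> 'a measure" and X W :: "nat \<Rightarrow> 'a \<Rightarrow> real" and f :: "real \<Rightarrow> real"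
  assumes M: "\<And>n. prob_space (M n)" and \<mu>: "real_distribution \<mu>"
    and X [measurable]: "\<And>n. X n \<in> borel_measurable (M n)"
    and W [measurable]: "\<And>n. W n \<in> borel_measurable (M n)"
    and bounds: "\<And>n x. 0 \<le> W n x" "\<And>n x. W n x \<le> C"
    and chars: "\<And>u. (\<lambda>n. \<integral>x. iexp (u * X n x) * of_real (W n x) \<partial>M n) \<longlonglongrightarrow> char \<mu> u * of_real w"
    and w: "w > 0"
    and f: "continuous_on UNIV f" "bounded (range f)"
  shows "(\<lambda>n. \<integral>x. f (X n x) * W n x \<partial>M n) \<longlonglongrightarrow> (\<integral>x. f x \<partial>\<mu>) * w"
proof -
  interpret \<mu>: real_distribution \<mu> by fact
  define e where "e n = (\<integral>x. W n x \<partial>M n)" for n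
  have int_W: "integrable (M n) (W n)" for n
  proof -
    interpret prob_space "M n" by (rule M)
    show ?thesis
      by (rule integrable_const_bound[where B = C]) (use bounds in auto)
  qed
  have "(\<lambda>n. complex_of_real (e n)) \<longlonglongrightarrow> of_real w"
    using chars[of 0] by (simp add: e_def \<mu>.char_zero)
  then have e: "e \<longlonglongrightarrow> w" by (simp add: tendsto_of_real_iff)
  then have ev: "eventually (\<lambda>n. e n > 0) sequentially"
    using w by (rule order_tendstoD)
  \<comment> \<open>the limit itself serves as a placeholder for the finitely many \<open>n\<close> without a density\<close>
  define \<nu> where "\<nu> n = (if e n > 0 then distr (density (M n) (\<lambda>x. ennreal (W n x / e n))) borel (X n) else \<mu>)" for n
  have \<nu>: "real_distribution (\<nu> n)" for n
  proof (cases "e n > 0")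
    case True
    have "prob_space (density (M n) (\<lambda>x. ennreal (W n x / e n)))"
    proof (rule prob_spaceI)
      have "emeasure (density (M n) (\<lambda>x. ennreal (W n x / e n))) (space (M n)) =
          (\<integral>\<^sup>+x. ennreal (W n x / e n) \<partial>M n)"
        by (subst emeasure_density) (auto intro!: nn_integral_cong)
      also have "\<dots> = ennreal (\<integral>x. W n x / e n \<partial>M n)"
        using True bounds int_W by (intro nn_integral_eq_integral) auto
      also have "\<dots> = 1" using True by (simp add: e_def)
      finally show "emeasure (density (M n) (\<lambda>x. ennreal (W n x / e n)))
          (space (density (M n) (\<lambda>x. ennreal (W n x / e n)))) = 1" by simp
    qed
    then show ?thesis
      using True by (auto simp: \<nu>_def intro!: prob_space.real_distribution_distr)
  qed (simp add: \<nu>_def \<mu>)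
  have int_\<nu>: "(\<integral>x. g x \<partial>\<nu> n) = (\<integral>x. (W n x / e n) *\<^sub>R g (X n x) \<partial>M n)"
    if "e n > 0" and [measurable]: "g \<in> borel_measurable borel"
    for n and g :: "real \<Rightarrow> 'b::{banach, second_countable_topology}"
  proof -
    have "(\<integral>x. g x \<partial>\<nu> n) = (\<integral>x. g (X n x) \<partial>density (M n) (\<lambda>x. ennreal (W n x / e n)))"
      using that by (simp add: \<nu>_def integral_distr)
    also have "\<dots> = (\<integral>x. (W n x / e n) *\<^sub>R g (X n x) \<partial>M n)"
      using that bounds by (subst integral_density) auto
    finally show ?thesis .
  qed
  have "(\<lambda>n. char (\<nu> n) u) \<longlonglongrightarrow> char \<mu> u" for u
  proof -
    have "(\<lambda>n. (\<integral>x. iexp (u * X n x) * of_real (W n x) \<partial>M n) / of_real (e n)) \<longlonglongrightarrow> char \<mu> u * of_real w / of_real w"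
      using w by (intro tendsto_intros chars e) auto
    moreover have "eventually (\<lambda>n. (\<integral>x. iexp (u * X n x) * of_real (W n x) \<partial>M n) / of_real (e n) = char (\<nu> n) u) sequentially"
      using ev
    proof eventually_elim
      case (elim n)
      have "char (\<nu> n) u = (\<integral>x. iexp (u * X n x) * of_real (W n x) / of_real (e n) \<partial>M n)"
        unfolding char_def using elim
        by (subst int_\<nu>) (auto simp: scaleR_conv_of_real mult_ac)
      then show ?case by simp
    qed
    ultimately show ?thesis
      using w by (simp add: Lim_transform_eventually)
  qed
  then have "weak_conv_m \<nu> \<mu>"
    by (intro levy_continuity \<nu> \<mu>)
  moreover obtain B where "\<And>x. norm (f x) \<le> B"
    using f(2) by (auto simp: bounded_iff)
  ultimately have "(\<lambda>n. \<integral>x. f x \<partial>\<nu> n) \<longlonglongrightarrow> (\<integral>x. f x \<partial>\<mu>)"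
    using f(1) \<nu> \<mu> by (intro weak_conv_imp_integral_bdd_continuous_conv) (auto simp: continuous_on_eq_continuous_at)
  then have "(\<lambda>n. (\<integral>x. f x \<partial>\<nu> n) * e n) \<longlonglongrightarrow> (\<integral>x. f x \<partial>\<mu>) * w"
    by (intro tendsto_mult e)
  moreover have "eventually (\<lambda>n. (\<integral>x. f x \<partial>\<nu> n) * e n = (\<integral>x. f (X n x) * W n x \<partial>M n)) sequentially"
    using ev
  proof eventually_elim
    case (elim n)
    have [measurable]: "f \<in> borel_measurable borel"
      using f(1) by (rule borel_measurable_continuous_onI)
    have "(\<integral>x. f x \<partial>\<nu> n) = (\<integral>x. f (X n x) * W n x / e n \<partial>M n)"
      using elim by (subst int_\<nu>) (auto simp: mult_ac)
    then show ?case using elim by simp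
  qed
  ultimately show ?thesis by (rule Lim_transform_eventually)
qed

lemma levy_continuity_integral:
  fixes M :: "nat \<Rightarrow> 'a measure" and X :: "nat \<Rightarrow> 'a \<Rightarrow> real" and f :: "real \<Rightarrow> real"
  assumes "\<And>n. prob_space (M n)" "real_distribution \<mu>" "\<And>n. X n \<in> borel_measurable (M n)"
    and "\<And>u. (\<lambda>n. \<integral>x. iexp (u * X n x) \<partial>M n) \<longlonglongrightarrow> char \<mu> u"
    and "continuous_on UNIV f" "bounded (range f)"
  shows "(\<lambda>n. \<integral>x. f (X n x) \<partial>M n) \<longlonglongrightarrow> (\<integral>x. f x \<partial>\<mu>)"
  using weighted_levy_continuity[of M \<mu> X "\<lambda>_ _. 1" 1 1 f] assms by simp

lemma (in prob_space) integrable_bounded: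
  fixes f :: "'a \<Rightarrow> 'b::{banach, second_countable_topology}"
  assumes "f \<in> borel_measurable M" "\<And>x. norm (f x) \<le> B"
  shows "integrable M f"
  by (rule integrable_const_bound[where B = B]) (use assms in auto)

text \<open>
  The weights \<open>2 + cos (v Y)\<close> and \<open>2 + sin (v Y)\<close> are positive and turn the joint characteristic
  functions into characteristic functions of \<open>X\<close>, which introduces an arbitrary test function \<open>f\<close> of
  \<open>X\<close>. A positive translate of \<open>f\<close> then serves as the weight when the same argument is applied to
  \<open>Y\<close>.
\<close>
lemma product_test_functions_converge:
  fixes M :: "nat \<Rightarrow> 'a measure" and X Y :: "nat \<Rightarrow> 'a \<Rightarrow> real" and f g :: "real \<Rightarrow> real"
  assumes M: "\<And>n. prob_space (M n)" and \<mu>: "real_distribution \<mu>" and \<nu>: "real_distribution \<nu>"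
    and X [measurable]: "\<And>n. X n \<in> borel_measurable (M n)"
    and Y [measurable]: "\<And>n. Y n \<in> borel_measurable (M n)"
    and chars: "\<And>u v. (\<lambda>n. \<integral>x. iexp (u * X n x + v * Y n x) \<partial>M n) \<longlonglongrightarrow> char \<mu> u * char \<nu> v"
    and f: "continuous_on UNIV f" "bounded (range f)"
    and g: "continuous_on UNIV g" "bounded (range g)"
  shows "(\<lambda>n. \<integral>x. f (X n x) * g (Y n x) \<partial>M n) \<longlonglongrightarrow> (\<integral>x. f x \<partial>\<mu>) * (\<integral>x. g x \<partial>\<nu>)"
proof -
  interpret M: prob_space "M n" for n by (rule M)
  interpret \<mu>: real_distribution \<mu> by fact
  interpret \<nu>: real_distribution \<nu> by fact
  obtain K where K: "\<And>x. norm (f x) \<le> K" using f(2) by (auto simp: bounded_iff)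
  obtain K' where K': "\<And>x. norm (g x) \<le> K'" using g(2) by (auto simp: bounded_iff)
  have "K \<ge> 0" "K' \<ge> 0" using K K' norm_ge_zero order_trans by blast+
  have [measurable]: "f \<in> borel_measurable borel" "g \<in> borel_measurable borel"
    using f g by (auto intro: borel_measurable_continuous_onI)
  have int_f: "integrable (M n) (\<lambda>x. f (X n x))" for n
    by (rule M.integrable_bounded[where B = K]) (use K in auto)
  have int_g: "integrable (M n) (\<lambda>x. g (Y n x))" for n
    by (rule M.integrable_bounded[where B = K']) (use K' in auto)
  have int_fg: "integrable (M n) (\<lambda>x. f (X n x) * g (Y n x))" for n
    by (rule M.integrable_bounded[where B = "K * K'"])
      (use K K' \<open>K \<ge> 0\<close> in \<open>auto simp: abs_mult intro!: mult_mono\<close>)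
  have int_iexp: "integrable (M n) (\<lambda>x. iexp (h x))" if [measurable]: "h \<in> borel_measurable (M n)" for n h
    by (rule M.integrable_bounded[where B = 1]) auto
  have char_X: "(\<lambda>n. \<integral>x. iexp (u * X n x) \<partial>M n) \<longlonglongrightarrow> char \<mu> u" for u
    using chars[of u 0] by (simp add: \<nu>.char_zero)
  have char_Y: "(\<lambda>n. \<integral>x. iexp (u * Y n x) \<partial>M n) \<longlonglongrightarrow> char \<nu> u" for u
    using chars[of 0 u] by (simp add: \<mu>.char_zero)
  have lim_f: "(\<lambda>n. \<integral>x. f (X n x) \<partial>M n) \<longlonglongrightarrow> (\<integral>x. f x \<partial>\<mu>)"
    by (rule levy_continuity_integral[OF M \<mu> X char_X f])
  have lim_g: "(\<lambda>n. \<integral>x. g (Y n x) \<partial>M n) \<longlonglongrightarrow> (\<integral>x. g x \<partial>\<nu>)"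
    by (rule levy_continuity_integral[OF M \<nu> Y char_Y g])
  have cnj: "char \<nu> (- v) = cnj (char \<nu> v)" for v
    unfolding char_def by (subst Bochner_Integration.integral_cnj[symmetric]) (simp add: exp_cnj)
  have lim_fe: "(\<lambda>n. \<integral>x. f (X n x) *\<^sub>R iexp (v * Y n x) \<partial>M n) \<longlonglongrightarrow> (\<integral>x. f x \<partial>\<mu>) *\<^sub>R char \<nu> v" for v
  proof -
    \<comment> \<open>both trigonometric functions at once: \<open>t\<close> is \<open>cos\<close> or \<open>sin\<close>, \<open>c\<close> and \<open>d\<close> its Euler coefficients, \<open>w\<close> the limit\<close>
    have trig: "(\<lambda>n. \<integral>x. f (X n x) * t (v * Y n x) \<partial>M n) \<longlonglongrightarrow> (\<integral>x. f x \<partial>\<mu>) * w"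
      if t: "\<And>y. of_real (t y) = c * iexp y + d * iexp (- y)" and [measurable]: "t \<in> borel_measurable borel"
        and t_le: "\<And>y. \<bar>t y\<bar> \<le> 1" and w: "of_real w = c * char \<nu> v + d * char \<nu> (- v)" and w_le: "\<bar>w\<bar> \<le> 1"
      for t :: "real \<Rightarrow> real" and w and c d
    proof -
      have "(\<lambda>n. \<integral>x. f (X n x) * (2 + t (v * Y n x)) \<partial>M n) \<longlonglongrightarrow> (\<integral>x. f x \<partial>\<mu>) * (2 + w)"
      proof (rule weighted_levy_continuity[OF M \<mu> X, where C = 3])
        show "0 \<le> 2 + t (v * Y n x)" "2 + t (v * Y n x) \<le> 3" for n x
          using t_le[of "v * Y n x"] by auto
        show "0 < 2 + w" using w_le by auto
        fix u
        have "(\<integral>x. iexp (u * X n x) * of_real (2 + t (v * Y n x)) \<partial>M n) =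
            2 * (\<integral>x. iexp (u * X n x) \<partial>M n) + (c * (\<integral>x. iexp (u * X n x + v * Y n x) \<partial>M n) +
              d * (\<integral>x. iexp (u * X n x + (- v) * Y n x) \<partial>M n))" for n
        proof -
          have "iexp (u * X n x) * of_real (2 + t (v * Y n x)) =
              2 * iexp (u * X n x) + (c * iexp (u * X n x + v * Y n x) + d * iexp (u * X n x + (- v) * Y n x))" for x
            by (simp add: t algebra_simps exp_add[symmetric])
          then have "(\<integral>x. iexp (u * X n x) * of_real (2 + t (v * Y n x)) \<partial>M n) =
            (\<integral>x. 2 * iexp (u * X n x) + (c * iexp (u * X n x + v * Y n x) + d * iexp (u * X n x + (- v) * Y n x)) \<partial>M n)"
            by simp
          also have "\<dots> = (\<integral>x. 2 * iexp (u * X n x) \<partial>M n) + ((\<integral>x. c * iexp (u * X n x + v * Y n x) \<partial>M n) +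
              (\<integral>x. d * iexp (u * X n x + (- v) * Y n x) \<partial>M n))"
            by (subst Bochner_Integration.integral_add Bochner_Integration.integral_add[of "M n" "\<lambda>x. c * _ x"];
                (intro Bochner_Integration.integrable_add integrable_mult_right int_iexp)?; measurable)+
          finally show ?thesis by (simp only: integral_mult_right_zero)
        qed
        moreover have "(\<lambda>n. 2 * (\<integral>x. iexp (u * X n x) \<partial>M n) + (c * (\<integral>x. iexp (u * X n x + v * Y n x) \<partial>M n) +
              d * (\<integral>x. iexp (u * X n x + (- v) * Y n x) \<partial>M n))) \<longlonglongrightarrow>
            2 * char \<mu> u + (c * (char \<mu> u * char \<nu> v) + d * (char \<mu> u * char \<nu> (- v)))"
          by (intro tendsto_intros chars char_X)
        moreover have "2 * char \<mu> u + (c * (char \<mu> u * char \<nu> v) + d * (char \<mu> u * char \<nu> (- v))) = char \<mu> u * of_real (2 + w)"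
          by (simp add: w algebra_simps)
        ultimately show "(\<lambda>n. \<integral>x. iexp (u * X n x) * of_real (2 + t (v * Y n x)) \<partial>M n) \<longlonglongrightarrow> char \<mu> u * of_real (2 + w)"
          by simp
      qed (use f in measurable)
      from tendsto_diff[OF this tendsto_mult[OF tendsto_const[of 2] lim_f]]
      have "(\<lambda>n. (\<integral>x. f (X n x) * (2 + t (v * Y n x)) \<partial>M n) - 2 * (\<integral>x. f (X n x) \<partial>M n)) \<longlonglongrightarrow> (\<integral>x. f x \<partial>\<mu>) * w"
        by (simp add: algebra_simps)
      moreover have "(\<integral>x. f (X n x) * (2 + t (v * Y n x)) \<partial>M n) - 2 * (\<integral>x. f (X n x) \<partial>M n) =
          (\<integral>x. f (X n x) * t (v * Y n x) \<partial>M n)" for n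
      proof -
        have "integrable (M n) (\<lambda>x. f (X n x) * (2 + t (v * Y n x)))"
        proof (rule M.integrable_bounded[where B = "K * 3"])
          show "norm (f (X n x) * (2 + t (v * Y n x))) \<le> K * 3" for x
            using K[of "X n x"] t_le[of "v * Y n x"] \<open>K \<ge> 0\<close> unfolding norm_mult
            by (intro mult_mono) auto
        qed measurable
        from Bochner_Integration.integral_diff[OF this integrable_mult_right[OF int_f[of n], of 2]]
        show ?thesis by (simp add: algebra_simps)
      qed
      ultimately show ?thesis by simp
    qed
    have bound: "\<bar>Re (char \<nu> v)\<bar> \<le> 1" "\<bar>Im (char \<nu> v)\<bar> \<le> 1"
      using \<nu>.cmod_char_le_1[of v] abs_Re_le_cmod[of "char \<nu> v"] abs_Im_le_cmod[of "char \<nu> v"] by linarith+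
    have euler: "of_real (cos y) = (1/2) * iexp y + (1/2) * iexp (- y)"
      "of_real (sin y) = (- \<i> / 2) * iexp y + (\<i> / 2) * iexp (- y)" for y
      by (auto simp: complex_eq_iff Re_exp Im_exp)
    have char_parts: "of_real (Re (char \<nu> v)) = (1/2) * char \<nu> v + (1/2) * char \<nu> (- v)"
      "of_real (Im (char \<nu> v)) = (- \<i> / 2) * char \<nu> v + (\<i> / 2) * char \<nu> (- v)"
      unfolding cnj by (auto simp: complex_eq_iff)
    have
      "(\<lambda>n. \<integral>x. f (X n x) * cos (v * Y n x) \<partial>M n) \<longlonglongrightarrow> (\<integral>x. f x \<partial>\<mu>) * Re (char \<nu> v)"
      "(\<lambda>n. \<integral>x. f (X n x) * sin (v * Y n x) \<partial>M n) \<longlonglongrightarrow> (\<integral>x. f x \<partial>\<mu>) * Im (char \<nu> v)"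
      by (rule trig[OF euler(1) _ _ char_parts(1) bound(1)]; simp)
        (rule trig[OF euler(2) _ _ char_parts(2) bound(2)]; simp)
    moreover have "Re (\<integral>x. f (X n x) *\<^sub>R iexp (v * Y n x) \<partial>M n) = (\<integral>x. f (X n x) * cos (v * Y n x) \<partial>M n)"
      "Im (\<integral>x. f (X n x) *\<^sub>R iexp (v * Y n x) \<partial>M n) = (\<integral>x. f (X n x) * sin (v * Y n x) \<partial>M n)" for n
    proof -
      have int: "integrable (M n) (\<lambda>x. f (X n x) *\<^sub>R iexp (v * Y n x))"
        by (rule M.integrable_bounded[where B = K]) (use K in auto)
      show "Re (\<integral>x. f (X n x) *\<^sub>R iexp (v * Y n x) \<partial>M n) = (\<integral>x. f (X n x) * cos (v * Y n x) \<partial>M n)"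
        "Im (\<integral>x. f (X n x) *\<^sub>R iexp (v * Y n x) \<partial>M n) = (\<integral>x. f (X n x) * sin (v * Y n x) \<partial>M n)"
        using integral_Re[OF int] integral_Im[OF int] by (simp_all add: Re_exp Im_exp)
    qed
    ultimately show ?thesis by (simp add: tendsto_complex_iff)
  qed
  have "(\<lambda>n. \<integral>x. g (Y n x) * (f (X n x) + (K + 1)) \<partial>M n) \<longlonglongrightarrow> (\<integral>x. g x \<partial>\<nu>) * ((\<integral>x. f x \<partial>\<mu>) + (K + 1))"
  proof (rule weighted_levy_continuity[OF M \<nu> Y, where C = "2 * K + 1"])
    show "0 \<le> f (X n x) + (K + 1)" "f (X n x) + (K + 1) \<le> 2 * K + 1" for n x
      using K[of "X n x"] by auto
    have "integrable \<mu> f" by (rule \<mu>.integrable_bounded[where B = K]) (use K in auto)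
    then have "(\<integral>x. - K \<partial>\<mu>) \<le> (\<integral>x. f x \<partial>\<mu>)"
      using K by (intro integral_mono) (auto simp: abs_le_iff intro: minus_le_iff[THEN iffD1])
    then show "0 < (\<integral>x. f x \<partial>\<mu>) + (K + 1)" using \<mu>.prob_space by simp
    fix v
    have "(\<integral>x. iexp (v * Y n x) * of_real (f (X n x) + (K + 1)) \<partial>M n) =
        (\<integral>x. f (X n x) *\<^sub>R iexp (v * Y n x) \<partial>M n) + of_real (K + 1) * (\<integral>x. iexp (v * Y n x) \<partial>M n)" for n
    proof -
      have "integrable (M n) (\<lambda>x. f (X n x) *\<^sub>R iexp (v * Y n x))"
        by (rule M.integrable_bounded[where B = K]) (use K in auto)
      moreover have "integrable (M n) (\<lambda>x. of_real (K + 1) * iexp (v * Y n x))"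
        by (intro integrable_mult_right int_iexp) measurable
      moreover have "iexp (v * Y n x) * of_real (f (X n x) + (K + 1)) =
          f (X n x) *\<^sub>R iexp (v * Y n x) + of_real (K + 1) * iexp (v * Y n x)" for x
        by (simp add: scaleR_conv_of_real algebra_simps)
      ultimately show ?thesis
        by (simp only: Bochner_Integration.integral_add integral_mult_right_zero)
    qed
    moreover have "(\<lambda>n. (\<integral>x. f (X n x) *\<^sub>R iexp (v * Y n x) \<partial>M n) + of_real (K + 1) * (\<integral>x. iexp (v * Y n x) \<partial>M n))
      \<longlonglongrightarrow> (\<integral>x. f x \<partial>\<mu>) *\<^sub>R char \<nu> v + of_real (K + 1) * char \<nu> v"
      by (intro tendsto_intros lim_fe char_Y)
    ultimately show "(\<lambda>n. \<integral>x. iexp (v * Y n x) * of_real (f (X n x) + (K + 1)) \<partial>M n) \<longlonglongrightarrow>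
        char \<nu> v * of_real ((\<integral>x. f x \<partial>\<mu>) + (K + 1))"
      by (simp add: scaleR_conv_of_real algebra_simps)
  qed (use g in measurable)
  from tendsto_diff[OF this tendsto_mult[OF tendsto_const[of "K + 1"] lim_g]]
  have "(\<lambda>n. (\<integral>x. g (Y n x) * (f (X n x) + (K + 1)) \<partial>M n) - (K + 1) * (\<integral>x. g (Y n x) \<partial>M n)) \<longlonglongrightarrow>
      (\<integral>x. f x \<partial>\<mu>) * (\<integral>x. g x \<partial>\<nu>)"
    by (simp add: algebra_simps)
  moreover have "(\<integral>x. g (Y n x) * (f (X n x) + (K + 1)) \<partial>M n) - (K + 1) * (\<integral>x. g (Y n x) \<partial>M n) =
      (\<integral>x. f (X n x) * g (Y n x) \<partial>M n)" for n
  proof -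
    have "g (Y n x) * (f (X n x) + (K + 1)) = f (X n x) * g (Y n x) + (K + 1) * g (Y n x)" for x
      by (simp add: algebra_simps)
    then show ?thesis
      using Bochner_Integration.integral_add[OF int_fg[of n] integrable_mult_right[OF int_g[of n], of "K + 1"]]
      by simp
  qed
  ultimately show ?thesis by simp
qed

lemma integral_pair_measure_mult:
  fixes f g :: "real \<Rightarrow> real"
  assumes \<mu>: "real_distribution \<mu>" and \<nu>: "real_distribution \<nu>"
    and f: "continuous_on UNIV f" "bounded (range f)"
    and g: "continuous_on UNIV g" "bounded (range g)"
  shows "(\<integral>z. f (fst z) * g (snd z) \<partial>(\<mu> \<Otimes>\<^sub>M \<nu>)) = (\<integral>x. f x \<partial>\<mu>) * (\<integral>x. g x \<partial>\<nu>)"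
proof -
  interpret \<mu>: real_distribution \<mu> by fact
  interpret \<nu>: real_distribution \<nu> by fact
  interpret pair_prob_space \<mu> \<nu> ..
  obtain K where K: "\<And>x. norm (f x) \<le> K" using f(2) by (auto simp: bounded_iff)
  obtain K' where K': "\<And>x. norm (g x) \<le> K'" using g(2) by (auto simp: bounded_iff)
  have "K \<ge> 0" using K norm_ge_zero order_trans by blast
  have [measurable]: "f \<in> borel_measurable borel" "g \<in> borel_measurable borel"
    using f g by (auto intro: borel_measurable_continuous_onI)
  have "integrable (\<mu> \<Otimes>\<^sub>M \<nu>) (\<lambda>z. f (fst z) * g (snd z))"
    by (rule integrable_bounded[where B = "K * K'"])
      (use K K' \<open>K \<ge> 0\<close> in \<open>auto simp: abs_mult intro!: mult_mono\<close>)
  from integral_fst'[OF this] show ?thesis by simp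
qed

text \<open>
  The algebra generated by continuous functions of a single coordinate. It contains the polynomials,
  so it is dense on compact sets.
\<close>
inductive separable_sum :: "(real \<times> real \<Rightarrow> real) \<Rightarrow> bool" where
  mult: "continuous_on UNIV f \<Longrightarrow> continuous_on UNIV g \<Longrightarrow> separable_sum (\<lambda>z. f (fst z) * g (snd z))"
| add: "separable_sum F \<Longrightarrow> separable_sum G \<Longrightarrow> separable_sum (\<lambda>z. F z + G z)"

lemma separable_sum_mult:
  assumes "separable_sum F" "separable_sum G"
  shows "separable_sum (\<lambda>z. F z * G z)"
  using assms
proof (induction F)
  case (mult f g)
  from mult(3) show ?case
  proof (induction G)
    case (mult f' g')
    have "separable_sum (\<lambda>z. (\<lambda>x. f x * f' x) (fst z) * (\<lambda>y. g y * g' y) (snd z))"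
      using mult \<open>continuous_on UNIV f\<close> \<open>continuous_on UNIV g\<close>
      by (intro separable_sum.mult continuous_on_mult)
    then show ?case by (simp add: mult_ac)
  next
    case (add F G)
    then show ?case using separable_sum.add by (fastforce simp: distrib_left)
  qed
next
  case (add F F')
  then show ?case using separable_sum.add by (fastforce simp: distrib_right)
qed

lemma separable_sum_polynomial:
  fixes F :: "real \<times> real \<Rightarrow> real"
  assumes "real_polynomial_function F" shows "separable_sum F"
  using assms
proof induction
  case (linear f)
  interpret bounded_linear f by fact
  have split: "f z = f (fst z, 0) * 1 + 1 * f (0, snd z)" for z
    using add[of "(fst z, 0)" "(0, snd z)"] by simp
  have "separable_sum (\<lambda>z. (\<lambda>x. f (x, 0)) (fst z) * (\<lambda>_. 1) (snd z) + (\<lambda>_. 1) (fst z) * (\<lambda>y. f (0, y)) (snd z))"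
    by (intro separable_sum.intros continuous_on continuous_intros)
  then show ?case by (simp only: split[symmetric])
next
  case (const c)
  show ?case using separable_sum.mult[of "\<lambda>_. c" "\<lambda>_. 1"] by simp
qed (auto intro: separable_sum.add separable_sum_mult)

text \<open>
  A continuous cut-off: a polynomial in two variables need not be bounded, but multiplied by the cut-off of
  each coordinate it is a sum of products of bounded test functions.
\<close>
definition plateau :: "nat \<Rightarrow> real \<Rightarrow> real" where
  "plateau m x = max 0 (min 1 (real m + 1 - \<bar>x\<bar>))"

lemma plateau_bounds: "0 \<le> plateau m x" "plateau m x \<le> 1"
  by (auto simp: plateau_def)

lemma continuous_plateau [continuous_intros]: "continuous_on A (plateau m)"
  unfolding plateau_def by (intro continuous_intros)

lemma plateau_tendsto: "(\<lambda>m. plateau m x) \<longlonglongrightarrow> 1"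
proof (rule tendsto_eventually, rule eventually_sequentiallyI)
  fix m assume "nat \<lceil>\<bar>x\<bar>\<rceil> \<le> m"
  then show "plateau m x = 1" unfolding plateau_def by linarith
qed

lemma bounded_mult_plateau:
  assumes "continuous_on UNIV f" shows "bounded (range (\<lambda>x. f x * plateau m x))"
proof -
  let ?h = "\<lambda>x. f x * plateau m x"
  have "continuous_on {- (real m + 1)..real m + 1} ?h"
    by (intro continuous_intros continuous_on_subset[OF assms]) auto
  then have "bounded (insert 0 (?h ` {- (real m + 1)..real m + 1}))"
    by (intro bounded_insert[THEN iffD2] compact_imp_bounded compact_continuous_image) auto
  moreover have "range ?h \<subseteq> insert 0 (?h ` {- (real m + 1)..real m + 1})"
  proof
    fix y assume "y \<in> range ?h"
    then obtain x where x: "y = ?h x" by blast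
    show "y \<in> insert 0 (?h ` {- (real m + 1)..real m + 1})"
    proof (cases "x \<in> {- (real m + 1)..real m + 1}")
      case False
      then have "plateau m x = 0" by (auto simp: plateau_def)
      then show ?thesis using x by simp
    qed (use x in blast)
  qed
  ultimately show ?thesis by (rule bounded_subset)
qed

text \<open>
  Let \<open>T\<close> be the product of the cut-offs of both coordinates. A test function \<open>f\<close> is replaced by
  \<open>g T\<close>, where the polynomial \<open>g\<close> is uniformly close to \<open>f\<close> on the support of \<open>T\<close>. The error is at
  most \<open>B (1 - T) + e\<close>, and the integral of \<open>1 - T\<close> is small under the limit, hence also under
  \<open>P n\<close> for large \<open>n\<close>: tightness is a consequence of the hypothesis, since \<open>T\<close> is itself a product
  of test functions.
\<close>
lemma product_test_functions_imp_weakly_converges: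
  fixes P :: "nat \<Rightarrow> (real \<times> real) measure" and L :: "(real \<times> real) measure"
  assumes P: "\<And>n. prob_space (P n)" "\<And>n. sets (P n) = sets borel"
    and L: "prob_space L" "sets L = sets borel"
    and conv: "\<And>f g :: real \<Rightarrow> real. \<lbrakk>continuous_on UNIV f; bounded (range f); continuous_on UNIV g; bounded (range g)\<rbrakk> \<Longrightarrow>
      (\<lambda>n. \<integral>z. f (fst z) * g (snd z) \<partial>P n) \<longlonglongrightarrow> (\<integral>z. f (fst z) * g (snd z) \<partial>L)"
  shows "weakly_converges P L"
  unfolding weakly_converges_def
proof (intro allI impI)
  fix f :: "real \<times> real \<Rightarrow> real" assume f: "continuous_on UNIV f \<and> bounded (range f)"
  interpret P: prob_space "P n" for n by (rule P(1))
  interpret L: prob_space L by (rule L(1))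
  define T where "T m z = plateau m (fst z) * plateau m (snd z)" for m and z :: "real \<times> real"
  have T: "0 \<le> T m z" "T m z \<le> 1" for m z
    unfolding T_def by (intro mult_nonneg_nonneg mult_le_one plateau_bounds)+
  have T_cont: "continuous_on UNIV (T m)" for m
    unfolding T_def
    by (intro continuous_on_mult continuous_on_compose2[OF continuous_plateau[of UNIV]] continuous_intros) auto
  note meas = P(2)[THEN measurable_cong_sets, OF refl] L(2)[THEN measurable_cong_sets, OF refl]
  have bm: "g \<in> borel_measurable (P n)" "g \<in> borel_measurable L"
    if "continuous_on UNIV g" for n and g :: "real \<times> real \<Rightarrow> real"
    using that unfolding meas by (auto intro: borel_measurable_continuous_onI)
  have int: "integrable (P n) g" "integrable L g"
    if "continuous_on UNIV g" "\<And>z. norm (g z) \<le> B" for n B and g :: "real \<times> real \<Rightarrow> real"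
    by (rule P.integrable_bounded[OF bm(1)[OF that(1)] that(2)], rule L.integrable_bounded[OF bm(2)[OF that(1)] that(2)])
  have truncated: "(continuous_on UNIV F \<and> (\<exists>B. \<forall>z. norm (F z * T m z) \<le> B)) \<and>
      (\<lambda>n. \<integral>z. F z * T m z \<partial>P n) \<longlonglongrightarrow> (\<integral>z. F z * T m z \<partial>L)"
    if "separable_sum F" for F m
    using that
  proof induction
    case (mult g h)
    let ?g = "\<lambda>x. g x * plateau m x" and ?h = "\<lambda>x. h x * plateau m x"
    have bdd: "bounded (range ?g)" "bounded (range ?h)"
      by (intro bounded_mult_plateau mult)+
    have eq: "g (fst z) * h (snd z) * T m z = ?g (fst z) * ?h (snd z)" for z
      by (simp add: T_def mult_ac)
    obtain B B' where "\<And>x. norm (?g x) \<le> B" "\<And>x. norm (?h x) \<le> B'"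
      using bdd by (auto simp: bounded_iff)
    then have "norm (g (fst z) * h (snd z) * T m z) \<le> B * B'" for z
      unfolding eq norm_mult by (metis mult_mono norm_ge_zero norm_mult order_trans)
    moreover have "(\<lambda>n. \<integral>z. ?g (fst z) * ?h (snd z) \<partial>P n) \<longlonglongrightarrow> (\<integral>z. ?g (fst z) * ?h (snd z) \<partial>L)"
      by (intro conv bdd continuous_on_mult mult continuous_plateau)
    moreover have "continuous_on UNIV (\<lambda>z::real\<times>real. g (fst z) * h (snd z))"
      by (intro continuous_on_mult continuous_on_compose2[OF mult(1)] continuous_on_compose2[OF mult(2)]
          continuous_intros) auto
    ultimately show ?case unfolding eq by blast
  next
    case (add F G)
    then obtain B B' where B: "\<And>z. norm (F z * T m z) \<le> B" "\<And>z. norm (G z * T m z) \<le> B'" by blast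
    have cont: "continuous_on UNIV (\<lambda>z. F z * T m z)" "continuous_on UNIV (\<lambda>z. G z * T m z)"
      using add by (auto intro!: continuous_on_mult T_cont)
    have eq: "(F z + G z) * T m z = F z * T m z + G z * T m z" for z by (simp add: algebra_simps)
    have "norm (F z * T m z + G z * T m z) \<le> B + B'" for z
      using norm_triangle_mono[OF B] .
    moreover have "(\<integral>z. F z * T m z + G z * T m z \<partial>P n) = (\<integral>z. F z * T m z \<partial>P n) + (\<integral>z. G z * T m z \<partial>P n)" for n
      using cont B by (intro Bochner_Integration.integral_add int(1))
    moreover have "(\<integral>z. F z * T m z + G z * T m z \<partial>L) = (\<integral>z. F z * T m z \<partial>L) + (\<integral>z. G z * T m z \<partial>L)"
      using cont B by (intro Bochner_Integration.integral_add int(2))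
    ultimately show ?case
      unfolding eq using add by (auto intro!: tendsto_add continuous_on_add)
  qed
  obtain B where B: "\<And>z. norm (f z) \<le> B" using f by (auto simp: bounded_iff)
  then have "B \<ge> 0" using norm_ge_zero order_trans by blast
  have T_lim: "(\<lambda>m. \<integral>z. T m z \<partial>L) \<longlonglongrightarrow> (\<integral>z. 1 \<partial>L)"
  proof (rule integral_dominated_convergence[where w = "\<lambda>_. 1"])
    show "AE z in L. (\<lambda>m. T m z) \<longlonglongrightarrow> 1"
      using tendsto_mult[OF plateau_tendsto plateau_tendsto] by (simp add: T_def)
  qed (use T T_cont in \<open>auto intro!: bm\<close>)
  show "(\<lambda>n. \<integral>z. f z \<partial>P n) \<longlonglongrightarrow> (\<integral>z. f z \<partial>L)"
  proof (rule tendstoI)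
    fix r :: real assume "r > 0"
    \<comment> \<open>the error is below \<open>B e + e\<close> for each of the two measures, plus \<open>e\<close> between them; this leaves a margin \<open>e\<close>\<close>
    define e where "e = r / (2 * B + 4)"
    have e: "e > 0" "2 * B * e + 4 * e = r"
      using \<open>r > 0\<close> \<open>B \<ge> 0\<close> by (auto simp: e_def field_simps add_pos_nonneg add_nonneg_eq_0_iff)
    have "eventually (\<lambda>m. (\<integral>z. T m z \<partial>L) > 1 - e) sequentially"
      using order_tendstoD(1)[OF T_lim, of "1 - e"] e by (simp add: L.prob_space)
    then obtain m where m: "(\<integral>z. T m z \<partial>L) > 1 - e"
      by (auto simp: eventually_sequentially)
    let ?box = "{- (real m + 1)..real m + 1} \<times> {- (real m + 1)..real m + 1}"
    have "compact ?box" "continuous_on ?box f"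
      using f by (auto intro: compact_Times continuous_on_subset)
    then obtain g where g: "real_polynomial_function g" "\<And>z. z \<in> ?box \<Longrightarrow> \<bar>f z - g z\<bar> < e"
      using Stone_Weierstrass_real_polynomial_function[OF _ _ e(1)] by blast
    note sep = separable_sum_polynomial[OF g(1)]
    have one: "separable_sum (\<lambda>_. 1)"
      using separable_sum.mult[of "\<lambda>_. 1" "\<lambda>_. 1"] by simp
    have near: "\<bar>f z - g z * T m z\<bar> \<le> B * (1 - T m z) + e" for z
    proof -
      have "\<bar>(f z - g z) * T m z\<bar> \<le> e"
      proof (cases "z \<in> ?box")
        case True
        then have "\<bar>f z - g z\<bar> * T m z \<le> e * 1"
          using g(2)[OF True] T e by (intro mult_mono) auto
        then show ?thesis using T by (simp add: abs_mult)
      next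
        case False
        then have "plateau m (fst z) = 0 \<or> plateau m (snd z) = 0"
          by (auto simp: plateau_def mem_Times_iff)
        then have "T m z = 0" by (auto simp: T_def)
        then show ?thesis using e by simp
      qed
      moreover have "\<bar>f z * (1 - T m z)\<bar> \<le> B * (1 - T m z)"
        using B[of z] T[of m z] by (auto simp: abs_mult intro!: mult_right_mono)
      ultimately show ?thesis by (auto simp: algebra_simps abs_le_iff)
    qed
    obtain B' where B': "\<And>z. norm (g z * T m z) \<le> B'" and g_cont: "continuous_on UNIV g"
      using truncated[OF sep] by blast
    have close: "\<bar>(\<integral>z. f z \<partial>Q) - (\<integral>z. g z * T m z \<partial>Q)\<bar> \<le> B * (1 - (\<integral>z. T m z \<partial>Q)) + e"
      if "prob_space Q" and i: "integrable Q f" "integrable Q (\<lambda>z. g z * T m z)" "integrable Q (T m)"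
      for Q
    proof -
      interpret Q: prob_space Q by fact
      have "\<bar>(\<integral>z. f z \<partial>Q) - (\<integral>z. g z * T m z \<partial>Q)\<bar> = \<bar>\<integral>z. f z - g z * T m z \<partial>Q\<bar>"
        using i by simp
      also have "\<dots> \<le> (\<integral>z. \<bar>f z - g z * T m z\<bar> \<partial>Q)"
        by (rule integral_abs_bound)
      also have "\<dots> \<le> (\<integral>z. B * (1 - T m z) + e \<partial>Q)"
        using i near by (intro integral_mono) auto
      also have "\<dots> = B * (1 - (\<integral>z. T m z \<partial>Q)) + e"
        using i by (simp add: Q.prob_space)
      finally show ?thesis .
    qed
    have gT_cont: "continuous_on UNIV (\<lambda>z. g z * T m z)"
      by (intro continuous_on_mult g_cont T_cont)
    have T_bound: "norm (T m z) \<le> 1" for z using T by simp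
    have "(\<lambda>n. \<integral>z. T m z \<partial>P n) \<longlonglongrightarrow> (\<integral>z. T m z \<partial>L)"
      using truncated[OF one, of m] by simp
    from order_tendstoD(1)[OF this m]
    have "eventually (\<lambda>n. (\<integral>z. T m z \<partial>P n) > 1 - e) sequentially" .
    moreover have "eventually (\<lambda>n. dist (\<integral>z. g z * T m z \<partial>P n) (\<integral>z. g z * T m z \<partial>L) < e) sequentially"
      using truncated[OF sep, of m] e by (intro tendstoD) auto
    ultimately show "eventually (\<lambda>n. dist (\<integral>z. f z \<partial>P n) (\<integral>z. f z \<partial>L) < r) sequentially"
    proof eventually_elim
      case (elim n)
      have "B * (1 - (\<integral>z. T m z \<partial>P n)) \<le> B * e" "B * (1 - (\<integral>z. T m z \<partial>L)) \<le> B * e"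
        using elim m \<open>B \<ge> 0\<close> by (auto intro!: mult_left_mono)
      then show ?case
        using elim e
          close[OF P(1) int(1)[OF conjunct1[OF f] B] int(1)[OF gT_cont B'] int(1)[OF T_cont T_bound], of n]
          close[OF L(1) int(2)[OF conjunct1[OF f] B] int(2)[OF gT_cont B'] int(2)[OF T_cont T_bound]]
        unfolding dist_real_def abs_less_iff abs_le_iff by (elim conjE) linarith
    qed
  qed
qed

lemma independent_levy_continuity:
  fixes M :: "nat \<Rightarrow> 'a measure" and X Y :: "nat \<Rightarrow> 'a \<Rightarrow> real"
  assumes M: "\<And>n. prob_space (M n)" and \<mu>: "real_distribution \<mu>" and \<nu>: "real_distribution \<nu>"
    and X [measurable]: "\<And>n. X n \<in> borel_measurable (M n)"
    and Y [measurable]: "\<And>n. Y n \<in> borel_measurable (M n)"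
    and chars: "\<And>u v. (\<lambda>n. \<integral>x. iexp (u * X n x + v * Y n x) \<partial>M n) \<longlonglongrightarrow> char \<mu> u * char \<nu> v"
  shows "weak_conv_m (\<lambda>n. distr (M n) borel (X n)) \<mu>"
    and "weak_conv_m (\<lambda>n. distr (M n) borel (Y n)) \<nu>"
    and "weakly_converges (\<lambda>n. distr (M n) borel (\<lambda>x. (X n x, Y n x))) (\<mu> \<Otimes>\<^sub>M \<nu>)"
proof -
  interpret M: prob_space "M n" for n by (rule M)
  interpret \<mu>: real_distribution \<mu> by fact
  interpret \<nu>: real_distribution \<nu> by fact
  interpret pair_prob_space \<mu> \<nu> ..
  show "weak_conv_m (\<lambda>n. distr (M n) borel (X n)) \<mu>"
  proof (rule levy_continuity)
    fix u show "(\<lambda>n. char (distr (M n) borel (X n)) u) \<longlonglongrightarrow> char \<mu> u"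
      using chars[of u 0] unfolding char_def[of "distr _ _ _"] by (simp add: integral_distr \<nu>.char_zero)
  qed (use \<mu> in auto)
  show "weak_conv_m (\<lambda>n. distr (M n) borel (Y n)) \<nu>"
  proof (rule levy_continuity)
    fix v show "(\<lambda>n. char (distr (M n) borel (Y n)) v) \<longlonglongrightarrow> char \<nu> v"
      using chars[of 0 v] unfolding char_def[of "distr _ _ _"] by (simp add: integral_distr \<mu>.char_zero)
  qed (use \<nu> in auto)
  have XY [measurable]: "(\<lambda>x. (X n x, Y n x)) \<in> borel_measurable (M n)" for n
    unfolding borel_prod[symmetric] by measurable
  show "weakly_converges (\<lambda>n. distr (M n) borel (\<lambda>x. (X n x, Y n x))) (\<mu> \<Otimes>\<^sub>M \<nu>)"
  proof (rule product_test_functions_imp_weakly_converges)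
    show "sets (\<mu> \<Otimes>\<^sub>M \<nu>) = sets borel"
      unfolding borel_prod[symmetric] by (intro sets_pair_measure_cong) auto
    fix f g :: "real \<Rightarrow> real"
    assume fg: "continuous_on UNIV f" "bounded (range f)" "continuous_on UNIV g" "bounded (range g)"
    have [measurable]: "f \<in> borel_measurable borel" "g \<in> borel_measurable borel"
      using fg by (auto intro: borel_measurable_continuous_onI)
    have "(\<lambda>z::real\<times>real. f (fst z) * g (snd z)) \<in> borel_measurable borel"
      unfolding borel_prod[symmetric] by measurable
    then show "(\<lambda>n. \<integral>z. f (fst z) * g (snd z) \<partial>distr (M n) borel (\<lambda>x. (X n x, Y n x))) \<longlonglongrightarrow>
        (\<integral>z. f (fst z) * g (snd z) \<partial>(\<mu> \<Otimes>\<^sub>M \<nu>))"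
      using product_test_functions_converge[OF M \<mu> \<nu> X Y chars fg]
      by (simp add: integral_distr integral_pair_measure_mult[OF \<mu> \<nu> fg])
  qed (auto intro: M.prob_space_distr P.prob_space_axioms)
qed

lemma centered_normal_char:
  assumes "v \<ge> 0"
  shows "real_distribution (centered_normal v)"
    and "char (centered_normal v) u = of_real (exp (- (v * u\<^sup>2) / 2))"
proof -
  let ?S = std_normal_distribution
  interpret S: real_distribution ?S by (rule real_dist_normal_dist)
  have "real_distribution (centered_normal v) \<and> char (centered_normal v) u = of_real (exp (- (v * u\<^sup>2) / 2))"
  proof (cases "v = 0")
    case True
    have "prob_space (return borel (0::real))" by (rule prob_space_return) simp
    moreover have "char (return borel 0) u = 1"
      unfolding char_def by (subst integral_return) auto
    ultimately show ?thesis
      using True by (simp add: centered_normal_def real_distribution_def real_distribution_axioms_def)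
  next
    case False
    then have v: "sqrt v > 0" using assms by simp
    have "distributed ?S lborel (\<lambda>x. x) std_normal_density"
      by (simp add: distributed_def distr_id2)
    from S.normal_density_affine[OF this, of "sqrt v" 0] v
    have "distributed ?S lborel (\<lambda>x. sqrt v * x) (normal_density 0 (sqrt v))" by simp
    then have "distr ?S lborel (\<lambda>x. sqrt v * x) = density lborel (normal_density 0 (sqrt v))"
      by (rule distributed_distr_eq_density)
    moreover have "distr ?S lborel (\<lambda>x. sqrt v * x) = distr ?S borel (\<lambda>x. sqrt v * x)"
      by (rule distr_cong) auto
    ultimately have eq: "centered_normal v = distr ?S borel (\<lambda>x. sqrt v * x)"
      using False by (simp add: centered_normal_def)
    have "char (centered_normal v) u = char ?S (u * sqrt v)"
      unfolding char_def eq by (subst integral_distr) (auto simp: mult_ac)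
    then show ?thesis
      using assms unfolding char_std_normal_distribution eq
      by (auto simp: power_mult_distrib mult_ac)
  qed
  then show "real_distribution (centered_normal v)"
    and "char (centered_normal v) u = of_real (exp (- (v * u\<^sup>2) / 2))" by auto
qed

section \<open>The joint characteristic function of the centred counts\<close>

lemma abs_exp_minus_linear:
  fixes x :: real
  assumes "x \<ge> 0" shows "\<bar>1 - x - exp (- x)\<bar> \<le> x\<^sup>2"
proof -
  have "exp (- x) \<ge> 1 - x" using exp_ge_add_one_self[of "- x"] by simp
  moreover have "exp (- x) \<le> 1 - x + x\<^sup>2"
  proof -
    have "1 \<le> 1 + x ^ 3" using assms by simp
    also have "\<dots> = (1 - x + x\<^sup>2) * (1 + x)"
      by (simp add: algebra_simps power2_eq_square power3_eq_cube)
    also have "\<dots> \<le> (1 - x + x\<^sup>2) * exp x"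
    proof (rule mult_left_mono[OF exp_ge_add_one_self])
      have "1 - x + x\<^sup>2 = (1 - x / 2)\<^sup>2 + 3 / 4 * x\<^sup>2" by (simp add: power2_eq_square algebra_simps)
      also have "\<dots> \<ge> 0" by simp
      finally show "0 \<le> 1 - x + x\<^sup>2" .
    qed
    finally show ?thesis by (simp add: exp_minus field_simps)
  qed
  ultimately show ?thesis by auto
qed

text \<open>
  Second order comparison of a centred finite law, bounded by \<open>h\<close>, with the normal law of the same
  variance. The third absolute moment is at most \<open>h v\<close>, so the error is small relative to \<open>v\<close>; it can
  therefore be added up over the steps, whose variances have a bounded sum after scaling.
\<close>
lemma finite_law_char_approx:
  fixes l W :: "'j \<Rightarrow> real"
  assumes J: "finite J" and l: "\<And>j. j \<in> J \<Longrightarrow> l j \<ge> 0" "(\<Sum>j\<in>J. l j) = 1"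
    and mean: "(\<Sum>j\<in>J. l j * W j) = 0" and var: "(\<Sum>j\<in>J. l j * (W j)\<^sup>2) = v"
    and bound: "\<And>j. j \<in> J \<Longrightarrow> \<bar>W j\<bar> \<le> h"
  shows "norm ((\<Sum>j\<in>J. of_real (l j) * iexp (W j)) - of_real (exp (- v / 2))) \<le> (h / 6 + h\<^sup>2 / 4) * v"
    and "norm (\<Sum>j\<in>J. of_real (l j) * iexp (W j)) \<le> 1"
    and "v \<ge> 0"
proof -
  show v: "v \<ge> 0" unfolding var[symmetric] using l by (intro sum_nonneg) auto
  show "norm (\<Sum>j\<in>J. of_real (l j) * iexp (W j)) \<le> 1"
    using l by (intro order_trans[OF norm_sum]) (simp add: norm_mult)
  define R where "R x = iexp x - (1 + \<i> * of_real x - of_real (x\<^sup>2 / 2))" for x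
  have R: "norm (R x) \<le> \<bar>x\<bar> ^ 3 / 6" for x
    using iexp_approx1[of x 2]
    by (simp add: R_def numeral_2_eq_2 numeral_3_eq_3 power2_eq_square algebra_simps fact_Suc)
  have "(\<Sum>j\<in>J. of_real (l j) * iexp (W j)) =
      (\<Sum>j\<in>J. of_real (l j) * R (W j) + (of_real (l j) + \<i> * of_real (l j * W j) - of_real (l j * (W j)\<^sup>2) / 2))"
    by (intro sum.cong refl) (simp add: R_def algebra_simps)
  also have "\<dots> = (\<Sum>j\<in>J. of_real (l j) * R (W j)) + (of_real (\<Sum>j\<in>J. l j) +
      \<i> * of_real (\<Sum>j\<in>J. l j * W j) - of_real (\<Sum>j\<in>J. l j * (W j)\<^sup>2) / 2)"
    by (simp only: sum.distrib sum_subtractf sum_distrib_left sum_divide_distrib of_real_sum)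
  also have "\<dots> = (\<Sum>j\<in>J. of_real (l j) * R (W j)) + of_real (1 - v / 2)"
    by (simp only: l(2) mean var) simp
  finally have eq: "(\<Sum>j\<in>J. of_real (l j) * iexp (W j)) - of_real (exp (- v / 2)) =
      (\<Sum>j\<in>J. of_real (l j) * R (W j)) + of_real (1 - v / 2 - exp (- v / 2))" by simp
  have "norm (\<Sum>j\<in>J. of_real (l j) * R (W j)) \<le> (\<Sum>j\<in>J. h / 6 * (l j * (W j)\<^sup>2))"
  proof (rule order_trans[OF norm_sum], rule sum_mono)
    fix j assume j: "j \<in> J"
    have "l j * norm (R (W j)) \<le> l j * (\<bar>W j\<bar> ^ 3 / 6)"
      using R l j by (intro mult_left_mono) auto
    also have "\<bar>W j\<bar> ^ 3 = \<bar>W j\<bar> * (W j)\<^sup>2"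
      by (simp add: power3_eq_cube power2_eq_square)
    also have "l j * (\<bar>W j\<bar> * (W j)\<^sup>2 / 6) \<le> l j * (h * (W j)\<^sup>2 / 6)"
      using bound l j by (intro mult_left_mono divide_right_mono mult_right_mono) auto
    finally show "norm (of_real (l j) * R (W j)) \<le> h / 6 * (l j * (W j)\<^sup>2)"
      using l j by (simp add: norm_mult mult_ac)
  qed
  then have 1: "norm (\<Sum>j\<in>J. of_real (l j) * R (W j)) \<le> h / 6 * v"
    by (simp only: sum_distrib_left[symmetric] var)
  have "v \<le> (\<Sum>j\<in>J. l j * h\<^sup>2)"
    unfolding var[symmetric]
  proof (intro sum_mono mult_left_mono l)
    show "(W j)\<^sup>2 \<le> h\<^sup>2" if "j \<in> J" for j
      using power_mono[OF bound[OF that], of 2] by simp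
  qed
  then have "v \<le> h\<^sup>2" by (simp add: sum_distrib_right[symmetric] l(2))
  then have "v * v \<le> h\<^sup>2 * v" using v by (intro mult_right_mono)
  then have "\<bar>1 - v / 2 - exp (- v / 2)\<bar> \<le> h\<^sup>2 / 4 * v"
    using abs_exp_minus_linear[of "v / 2"] v by (simp add: power2_eq_square)
  then have "norm (complex_of_real (1 - v / 2 - exp (- v / 2))) \<le> h\<^sup>2 / 4 * v"
    by (simp only: norm_of_real)
  then show "norm ((\<Sum>j\<in>J. of_real (l j) * iexp (W j)) - of_real (exp (- v / 2))) \<le> (h / 6 + h\<^sup>2 / 4) * v"
    unfolding eq distrib_right using 1 by (intro norm_triangle_mono)
qed

lemma bigo_1_over_ln_tendsto_0:
  fixes X :: "nat \<Rightarrow> real"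
  assumes "X \<in> O(\<lambda>_. 1)"
  shows "(\<lambda>n. X n / ln (real n)) \<longlonglongrightarrow> 0"
proof -
  obtain c where c: "eventually (\<lambda>n. \<bar>X n\<bar> \<le> c) sequentially"
    using assms by (auto elim!: landau_o.bigE)
  have ln: "filterlim (\<lambda>n. ln (real n)) at_top sequentially"
    by (rule filterlim_compose[OF ln_at_top filterlim_real_sequentially])
  have "eventually (\<lambda>n. norm (X n / ln (real n)) \<le> c * inverse (ln (real n))) sequentially"
    using c eventually_gt_at_top[of 1]
  proof eventually_elim
    case (elim n)
    then have "ln (real n) > 0" by simp
    then show ?case using elim by (simp add: divide_inverse abs_mult)
  qed
  moreover have "(\<lambda>n. c * inverse (ln (real n))) \<longlonglongrightarrow> 0"
    using tendsto_mult[OF tendsto_const tendsto_inverse_0_at_top[OF ln]] by simp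
  ultimately show ?thesis by (rule Lim_null_comparison)
qed

context random_staircase_tableau
begin

text \<open>
  The characteristic function and the variance of \<open>\<theta> (X - E X) + \<eta> (Y - E Y)\<close>, where \<open>(X, Y)\<close> is
  \<open>(1, 0)\<close>, \<open>(0, 1)\<close> or \<open>(1, 1)\<close> with probabilities \<open>q i\<close>, \<open>p i\<close> and \<open>1 - p i - q i\<close>; so \<open>X\<close> and
  \<open>Y\<close> have the means \<open>1 - p i\<close> and \<open>1 - q i\<close>.
\<close>
definition step_char :: "nat \<Rightarrow> real \<Rightarrow> real \<Rightarrow> complex" where
  "step_char i \<theta> \<eta> = of_real (q i) * iexp (p i * \<theta> - (1 - q i) * \<eta>) +
    of_real (p i) * iexp (q i * \<eta> - (1 - p i) * \<theta>) + of_real (1 - p i - q i) * iexp (p i * \<theta> + q i * \<eta>)"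

definition step_var :: "nat \<Rightarrow> real \<Rightarrow> real \<Rightarrow> real" where
  "step_var i \<theta> \<eta> = \<theta>\<^sup>2 * (p i * (1 - p i)) + \<eta>\<^sup>2 * (q i * (1 - q i)) - 2 * \<theta> * \<eta> * (p i * q i)"

lemma step_char_approx:
  "norm (step_char i \<theta> \<eta> - of_real (exp (- step_var i \<theta> \<eta> / 2))) \<le>
    ((\<bar>\<theta>\<bar> + \<bar>\<eta>\<bar>) / 6 + (\<bar>\<theta>\<bar> + \<bar>\<eta>\<bar>)\<^sup>2 / 4) * step_var i \<theta> \<eta>"
  "norm (step_char i \<theta> \<eta>) \<le> 1" "step_var i \<theta> \<eta> \<ge> 0"
proof -
  define l where "l = (\<lambda>j::nat. if j = 0 then q i else if j = 1 then p i else 1 - p i - q i)"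
  define W where "W = (\<lambda>j::nat. if j = 0 then p i * \<theta> - (1 - q i) * \<eta> else
    if j = 1 then q i * \<eta> - (1 - p i) * \<theta> else p i * \<theta> + q i * \<eta>)"
  let ?J = "{0, 1, 2::nat}"
  have pq': "0 \<le> p i" "0 \<le> q i" "p i + q i \<le> 1" by (rule pq)+
  have comb: "\<bar>x * \<theta> + y * \<eta>\<bar> \<le> \<bar>\<theta>\<bar> + \<bar>\<eta>\<bar>" if "\<bar>x\<bar> \<le> 1" "\<bar>y\<bar> \<le> 1" for x y
  proof -
    have "\<bar>x * \<theta>\<bar> \<le> 1 * \<bar>\<theta>\<bar>" "\<bar>y * \<eta>\<bar> \<le> 1 * \<bar>\<eta>\<bar>"
      using mult_right_mono[OF that(1), of "\<bar>\<theta>\<bar>"] mult_right_mono[OF that(2), of "\<bar>\<eta>\<bar>"]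
      by (simp_all add: abs_mult)
    then show ?thesis by linarith
  qed
  have "\<bar>W j\<bar> \<le> \<bar>\<theta>\<bar> + \<bar>\<eta>\<bar>" for j
    using comb[of "p i" "- (1 - q i)"] comb[of "- (1 - p i)" "q i"] comb[of "p i" "q i"] pq'
    by (auto simp: W_def algebra_simps)
  moreover have "(\<Sum>j\<in>?J. l j * W j) = 0" "(\<Sum>j\<in>?J. l j) = 1"
    "(\<Sum>j\<in>?J. l j * (W j)\<^sup>2) = step_var i \<theta> \<eta>"
    by (simp_all add: l_def W_def step_var_def algebra_simps power2_eq_square)
  moreover have "l j \<ge> 0" for j using pq' by (auto simp: l_def)
  moreover have "(\<Sum>j\<in>?J. of_real (l j) * iexp (W j)) = step_char i \<theta> \<eta>"
    by (simp add: l_def W_def step_char_def)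
  ultimately show "norm (step_char i \<theta> \<eta> - of_real (exp (- step_var i \<theta> \<eta> / 2))) \<le>
    ((\<bar>\<theta>\<bar> + \<bar>\<eta>\<bar>) / 6 + (\<bar>\<theta>\<bar> + \<bar>\<eta>\<bar>)\<^sup>2 / 4) * step_var i \<theta> \<eta>"
    "norm (step_char i \<theta> \<eta>) \<le> 1" "step_var i \<theta> \<eta> \<ge> 0"
    using finite_law_char_approx[of ?J l W "step_var i \<theta> \<eta>" "\<bar>\<theta>\<bar> + \<bar>\<eta>\<bar>"] by auto
qed

lemma joint_char:
  "(\<integral>S. iexp (\<theta> * (N_alpha S - measure_pmf.expectation (PT n) N_alpha) +
      \<eta> * (N_beta S - measure_pmf.expectation (PT n) N_beta)) \<partial>PT n) = (\<Prod>i<n. step_char i \<theta> \<eta>)"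
proof -
  let ?E = "measure_pmf.expectation (PT n)"
  have "iexp (\<theta> * (N_alpha S - ?E N_alpha) + \<eta> * (N_beta S - ?E N_beta)) =
      iexp \<theta> ^ count_symbol Alpha S * iexp \<eta> ^ count_symbol Beta S * iexp (- \<theta> * ?E N_alpha - \<eta> * ?E N_beta)" for S
    unfolding exp_of_nat_mult[symmetric] exp_add[symmetric] N_alpha_def N_beta_def
    by (rule arg_cong[where f = exp]) (simp add: algebra_simps)
  then have "?E (\<lambda>S. iexp (\<theta> * (N_alpha S - ?E N_alpha) + \<eta> * (N_beta S - ?E N_beta))) =
      (\<Sum>S\<in>tableaux n. of_real (tableau_prob n \<alpha> \<beta> S) * iexp \<theta> ^ count_symbol Alpha S * iexp \<eta> ^ count_symbol Beta S)
      * iexp (- \<theta> * ?E N_alpha - \<eta> * ?E N_beta)"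
    by (simp add: expectation_PT scaleR_conv_of_real sum_distrib_right mult.assoc)
  also have "- \<theta> * ?E N_alpha - \<eta> * ?E N_beta = (\<Sum>i<n. - \<theta> * (1 - p i) - \<eta> * (1 - q i))"
    unfolding mean_alpha mean_beta by (simp only: sum_distrib_left flip: sum_subtractf)
  also have "iexp (\<Sum>i<n. - \<theta> * (1 - p i) - \<eta> * (1 - q i)) = (\<Prod>i<n. iexp (- \<theta> * (1 - p i) - \<eta> * (1 - q i)))"
    by (simp only: of_real_sum sum_distrib_left exp_sum[OF finite_lessThan])
  finally have "?E (\<lambda>S. iexp (\<theta> * (N_alpha S - ?E N_alpha) + \<eta> * (N_beta S - ?E N_beta))) =
      (\<Prod>i<n. (of_real (q i) * iexp \<theta> + of_real (p i) * iexp \<eta> + of_real (1 - p i - q i) * (iexp \<theta> * iexp \<eta>)) *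
        iexp (- \<theta> * (1 - p i) - \<eta> * (1 - q i)))"
    unfolding probability_generating_function prod.distrib .
  also have "\<dots> = (\<Prod>i<n. step_char i \<theta> \<eta>)"
  proof (intro prod.cong refl)
    fix i
    have e: "iexp x * iexp y = iexp (x + y)" for x y
      by (simp add: exp_add[symmetric] algebra_simps)
    have exponents: "\<theta> + (- \<theta> * (1 - p i) - \<eta> * (1 - q i)) = p i * \<theta> - (1 - q i) * \<eta>"
      "\<eta> + (- \<theta> * (1 - p i) - \<eta> * (1 - q i)) = q i * \<eta> - (1 - p i) * \<theta>"
      "\<theta> + \<eta> + (- \<theta> * (1 - p i) - \<eta> * (1 - q i)) = p i * \<theta> + q i * \<eta>"
      "\<theta> + (q i * \<eta> - (1 - p i) * \<theta>) = p i * \<theta> + q i * \<eta>"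
      by (simp_all add: algebra_simps)
    show "(of_real (q i) * iexp \<theta> + of_real (p i) * iexp \<eta> + of_real (1 - p i - q i) * (iexp \<theta> * iexp \<eta>)) *
        iexp (- \<theta> * (1 - p i) - \<eta> * (1 - q i)) = step_char i \<theta> \<eta>"
      by (simp only: step_char_def distrib_right mult.assoc e exponents)
  qed
  finally show ?thesis .
qed

lemma joint_char_approx:
  fixes \<theta> \<eta> :: real
  defines "h \<equiv> \<bar>\<theta>\<bar> + \<bar>\<eta>\<bar>" and "v \<equiv> \<lambda>n. \<Sum>i<n. step_var i \<theta> \<eta>"
  shows "norm ((\<Prod>i<n. step_char i \<theta> \<eta>) - of_real (exp (- v n / 2))) \<le> (h / 6 + h\<^sup>2 / 4) * v n"
proof -
  have "of_real (exp (- v n / 2)) = (\<Prod>i<n. complex_of_real (exp (- step_var i \<theta> \<eta> / 2)))"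
    by (simp add: v_def exp_sum[symmetric] sum_negf sum_divide_distrib flip: of_real_prod)
  then have "norm ((\<Prod>i<n. step_char i \<theta> \<eta>) - of_real (exp (- v n / 2))) \<le>
      (\<Sum>i<n. norm (step_char i \<theta> \<eta> - of_real (exp (- step_var i \<theta> \<eta> / 2))))"
    using step_char_approx by (simp only:) (intro norm_prod_diff; simp)
  also have "\<dots> \<le> (\<Sum>i<n. (h / 6 + h\<^sup>2 / 4) * step_var i \<theta> \<eta>)"
    unfolding h_def by (intro sum_mono step_char_approx)
  finally show ?thesis by (simp add: v_def sum_distrib_left)
qed

lemma sum_step_var:
  "(\<Sum>i<n. step_var i \<theta> \<eta>) = \<theta>\<^sup>2 * measure_pmf.variance (PT n) N_alpha +
    \<eta>\<^sup>2 * measure_pmf.variance (PT n) N_beta + 2 * \<theta> * \<eta> * covariance (PT n) N_alpha N_beta"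
  unfolding step_var_def var_alpha var_beta covariance_alpha_beta
  by (simp add: sum.distrib sum_subtractf sum_distrib_left)

lemma variance_over_ln_tendsto:
  assumes "(\<lambda>n. V n - c * ln (real n)) \<in> O(\<lambda>_. 1)"
  shows "(\<lambda>n. V n / ln (real n)) \<longlonglongrightarrow> c"
proof -
  have "(\<lambda>n. (V n - c * ln (real n)) / ln (real n) + c) \<longlonglongrightarrow> 0 + c"
    by (intro tendsto_add bigo_1_over_ln_tendsto_0[OF assms] tendsto_const)
  moreover have "eventually (\<lambda>n. (V n - c * ln (real n)) / ln (real n) + c = V n / ln (real n)) sequentially"
    using eventually_gt_at_top[of 1]
  proof eventually_elim
    case (elim n)
    then have "ln (real n) > 0" by simp
    then show ?case by (simp add: field_simps)
  qed
  ultimately show ?thesis by (simp add: Lim_transform_eventually)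
qed

text \<open>
  With \<open>\<theta>\<close> and \<open>\<eta>\<close> of order \<open>1 / sqrt (ln n)\<close> the total variance of the steps tends to
  \<open>a u\<^sup>2 + b v\<^sup>2\<close>, while the factor in front of it in \<open>joint_char_approx\<close> tends to \<open>0\<close>.
\<close>
lemma joint_char_limit:
  "(\<lambda>n. \<integral>S. iexp (u * ((N_alpha S - measure_pmf.expectation (PT n) N_alpha) / sqrt (ln (real n))) +
      v * ((N_beta S - measure_pmf.expectation (PT n) N_beta) / sqrt (ln (real n)))) \<partial>PT n)
    \<longlonglongrightarrow> of_real (exp (- (a * u\<^sup>2) / 2)) * of_real (exp (- (b * v\<^sup>2) / 2))"
proof -
  define L where "L n = ln (real n)" for n
  define c where "c n = inverse (sqrt (L n))" for n
  define h where "h n = \<bar>u * c n\<bar> + \<bar>v * c n\<bar>" for n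
  define w where "w n = (\<Sum>i<n. step_var i (u * c n) (v * c n))" for n
  have "filterlim L at_top sequentially"
    unfolding L_def by (rule filterlim_compose[OF ln_at_top filterlim_real_sequentially])
  then have c: "c \<longlonglongrightarrow> 0"
    unfolding c_def by (intro tendsto_inverse_0_at_top filterlim_compose[OF sqrt_at_top])
  then have h: "h \<longlonglongrightarrow> 0"
    unfolding h_def by (auto intro!: tendsto_eq_intros)
  have L0: "L n \<ge> 0" for n
    unfolding L_def by (cases "n = 0") auto
  then have c2: "(c n)\<^sup>2 = 1 / L n" for n
    by (simp add: c_def inverse_eq_divide power_divide)
  have w_eq: "w n = u\<^sup>2 * (measure_pmf.variance (PT n) N_alpha / L n) +
    v\<^sup>2 * (measure_pmf.variance (PT n) N_beta / L n) + 2 * u * v * (covariance (PT n) N_alpha N_beta / L n)" for n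
  proof -
    have "2 * (u * c n) * (v * c n) = 2 * u * v * (c n)\<^sup>2" by (simp add: power2_eq_square)
    then show ?thesis
      unfolding w_def sum_step_var by (simp add: power_mult_distrib c2)
  qed
  have "(\<lambda>n. u\<^sup>2 * (measure_pmf.variance (PT n) N_alpha / L n) +
      v\<^sup>2 * (measure_pmf.variance (PT n) N_beta / L n) + 2 * u * v * (covariance (PT n) N_alpha N_beta / L n))
      \<longlonglongrightarrow> u\<^sup>2 * a + v\<^sup>2 * b + 2 * u * v * 0"
    unfolding L_def
    by (intro tendsto_intros variance_over_ln_tendsto variance_asymp bigo_1_over_ln_tendsto_0 covariance_bounded)
  then have "(\<lambda>n. w n) \<longlonglongrightarrow> u\<^sup>2 * a + v\<^sup>2 * b + 2 * u * v * 0"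
    by (simp only: w_eq)
  then have w: "w \<longlonglongrightarrow> a * u\<^sup>2 + b * v\<^sup>2" by (simp add: mult.commute)
  have "(\<lambda>n. (\<Prod>i<n. step_char i (u * c n) (v * c n)) - of_real (exp (- w n / 2))) \<longlonglongrightarrow> 0"
  proof (rule Lim_null_comparison)
    show "eventually (\<lambda>n. norm ((\<Prod>i<n. step_char i (u * c n) (v * c n)) - of_real (exp (- w n / 2)))
        \<le> (h n / 6 + (h n)\<^sup>2 / 4) * w n) sequentially"
      unfolding w_def h_def by (intro always_eventually allI joint_char_approx)
    have "(\<lambda>n. (h n / 6 + (h n)\<^sup>2 / 4) * w n) \<longlonglongrightarrow> (0 / 6 + 0\<^sup>2 / 4) * (a * u\<^sup>2 + b * v\<^sup>2)"
      by (intro tendsto_intros h w) simp_all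
    then show "(\<lambda>n. (h n / 6 + (h n)\<^sup>2 / 4) * w n) \<longlonglongrightarrow> 0" by simp
  qed
  moreover have "(\<lambda>n. complex_of_real (exp (- w n / 2))) \<longlonglongrightarrow> of_real (exp (- (a * u\<^sup>2 + b * v\<^sup>2) / 2))"
    by (intro tendsto_intros w) simp
  ultimately have "(\<lambda>n. (\<Prod>i<n. step_char i (u * c n) (v * c n)) - of_real (exp (- w n / 2)) +
      of_real (exp (- w n / 2))) \<longlonglongrightarrow> 0 + of_real (exp (- (a * u\<^sup>2 + b * v\<^sup>2) / 2))"
    by (rule tendsto_add)
  then have "(\<lambda>n. (\<Prod>i<n. step_char i (u * c n) (v * c n))) \<longlonglongrightarrow> of_real (exp (- (a * u\<^sup>2 + b * v\<^sup>2) / 2))"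
    by simp
  moreover have "exp (- (a * u\<^sup>2 + b * v\<^sup>2) / 2) = exp (- (a * u\<^sup>2) / 2) * exp (- (b * v\<^sup>2) / 2)"
    by (simp add: exp_add[symmetric] add_divide_distrib)
  moreover have "u * c n * x + v * c n * y = u * (x / sqrt (ln (real n))) + v * (y / sqrt (ln (real n)))" for n x y
    by (simp add: c_def L_def inverse_eq_divide)
  ultimately show ?thesis
    by (simp only: joint_char[symmetric] of_real_mult)
qed

end

section \<open>Moments and joint limit law\<close>

theorem theorem1p14:
  fixes \<alpha> \<beta> :: ennreal and a b :: real
    and P :: "nat \<Rightarrow> filling pmf" and EA EB :: "nat \<Rightarrow> real"
  assumes "\<alpha> > 0" and "\<beta> > 0"
    and "a = enn2real (inverse \<alpha>)" and "b = enn2real (inverse \<beta>)"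
    and "P = (\<lambda>n. tableau_pmf n \<alpha> \<beta>)"
    and "EA = (\<lambda>n. measure_pmf.expectation (P n) N_alpha)"
    and "EB = (\<lambda>n. measure_pmf.expectation (P n) N_beta)"
  shows "(\<lambda>n. EA n - (real n - a * ln (real n))) \<in> O(\<lambda>n. 1) \<and>
     (\<lambda>n. measure_pmf.variance (P n) N_alpha - a * ln (real n)) \<in> O(\<lambda>n. 1) \<and>
     (\<lambda>n. covariance (measure_pmf (P n)) N_alpha N_beta) \<in> O(\<lambda>n. 1) \<and>
     weak_conv_m
      (\<lambda>n. distr (P n) borel (\<lambda>S. (N_alpha S - EA n) / sqrt (ln (real n))))
      (centered_normal a) \<and>
     weak_conv_m
      (\<lambda>n. distr (P n) borel (\<lambda>S. (N_beta S - EB n) / sqrt (ln (real n))))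
      (centered_normal b) \<and>
     weakly_converges
      (\<lambda>n. distr (P n) borel
        (\<lambda>S. ((N_alpha S - EA n) / sqrt (ln (real n)), (N_beta S - EB n) / sqrt (ln (real n)))))
      (centered_normal a \<Otimes>\<^sub>M centered_normal b)"
proof -
  interpret random_staircase_tableau \<alpha> \<beta> a b
    using assms by unfold_locales
  have chars: "(\<lambda>n. \<integral>S. iexp (u * ((N_alpha S - EA n) / sqrt (ln (real n))) +
      v * ((N_beta S - EB n) / sqrt (ln (real n)))) \<partial>P n) \<longlonglongrightarrow>
      char (centered_normal a) u * char (centered_normal b) v" for u v
    using joint_char_limit[of u v] by (simp only: centered_normal_char nonneg assms(5-7))
  have prob: "prob_space (measure_pmf (P n))" for n
    by (rule prob_space_measure_pmf)
  note limits = independent_levy_continuity[OF prob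
      centered_normal_char(1)[OF nonneg(1)] centered_normal_char(1)[OF nonneg(2)] _ _ chars]
  show ?thesis
    using mean_alpha_asymp variance_asymp(1) covariance_bounded
    by (intro conjI limits) (simp_all add: assms)
qed

end
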